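(* Let $\bar x\in\mathbb{R}^d\setminus\{0\}$ and let $a\sim\mathsf{N}(0,I_d)$ be a standard Gaussian random vector in $\mathbb{R}^d$. Define $f_P\colon\mathbb{R}^d\to\mathbb{R}$ by $f_P(x):=\mathbb{E}_a\left[|\langle a,x\rangle^2-\langle a,\bar x\rangle^2|\right]$. Then the stationary points of $f_P$ are precisely the elements of $$\{0\}\cup\{\pm\bar x\}\cup\{x\in\bar x^{\perp}:\|x\|=c\cdot\|\bar x\|\},$$ where $c>0$ (approximately $c\approx0.4416$) is the unique solution of the equation $\frac{\pi}{4}=\frac{c}{1+c^2}+\arctan(c)$.
   Context: A point $x$ is stationary for $f$ if $0\in\partial f(x)$, where $\partial f$ is the limiting subdifferential: the Fréchet subdifferential $\hat\partial f(x)$ is the set of $v$ with $f(y)\ge f(x)+\langle v,y-x\rangle+o(\|y-x\|)$ as $y\to x$, and $\partial f(x)$ is the set of limits of vectors $v_i\in\hat\partial f(x_i)$ with $x_i\to x$, $f(x_i)\to f(x)$. $\|\cdot\|$ is the Euclidean norm and $\bar x^\perp=\{x:\langle x,\bar x\rangle=0\}$. *)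

theory Defs
  imports "HOL-Probability.Probability"
begin

text \<open>The remainder \<open>r\<close> is the $o(\|y-x\|)$ term of the Frechet subdifferential.\<close>

definition frechet_subdiff :: "('a::real_inner \<Rightarrow> real) \<Rightarrow> 'a \<Rightarrow> 'a set" where
  "frechet_subdiff f x =
     {v. \<exists>r. r \<in> o[at x](\<lambda>y. norm (y - x)) \<and>
          (\<forall>\<^sub>F y in at x. f y \<ge> f x + v \<bullet> (y - x) + r y)}"

definition limiting_subdiff :: "('a::real_inner \<Rightarrow> real) \<Rightarrow> 'a \<Rightarrow> 'a set" where
  "limiting_subdiff f x =
     {v. \<exists>(X :: nat \<Rightarrow> 'a) V.
          (\<forall>i. V i \<in> frechet_subdiff f (X i)) \<and>
          X \<longlonglongrightarrow> x \<and> (\<lambda>i. f (X i)) \<longlonglongrightarrow> f x \<and> V \<longlonglongrightarrow> v}"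

definition stationary :: "('a::real_inner \<Rightarrow> real) \<Rightarrow> 'a \<Rightarrow> bool" where
  "stationary f x \<longleftrightarrow> 0 \<in> limiting_subdiff f x"

definition std_gaussian_density :: "real ^ 'd \<Rightarrow> real" where
  "std_gaussian_density x = exp (- (norm x)\<^sup>2 / 2) / sqrt (2 * pi) ^ CARD('d)"

definition std_gaussian_vector :: "'w measure \<Rightarrow> ('w \<Rightarrow> real ^ 'd) \<Rightarrow> bool" where
  "std_gaussian_vector M a \<longleftrightarrow> prob_space M \<and> distributed M lborel a std_gaussian_density"

definition f_P :: "'w measure \<Rightarrow> ('w \<Rightarrow> real ^ 'd) \<Rightarrow> real ^ 'd \<Rightarrow> real ^ 'd \<Rightarrow> real" where
  "f_P M a xbar x =
     prob_space.expectation M (\<lambda>\<omega>. \<bar>(a \<omega> \<bullet> x)\<^sup>2 - (a \<omega> \<bullet> xbar)\<^sup>2\<bar>)"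

lemma std_gaussian_density_eq_prod:
  fixes x :: "real ^ 'd"
  shows "std_gaussian_density x = (\<Prod>i\<in>UNIV. std_normal_density (x $ i))"
proof -
  have "(norm x)\<^sup>2 = (\<Sum>i\<in>UNIV. (x $ i)\<^sup>2)"
    by (simp add: norm_vec_def L2_set_def sum_nonneg)
  then show ?thesis
    by (simp add: std_gaussian_density_def std_normal_density_def prod.distrib power_one_over
        exp_sum [symmetric] sum_negf sum_divide_distrib prod_dividef)
qed

end

theory Submission
  imports Defs
begin

text \<open>The function \<open>f_P + norm\<^sup>2\<close> is convex, so the limiting subdifferential collapses: \<open>x\<close> is
  stationary iff \<open>f_P x \<le> f_P y + (norm (y - x))\<^sup>2\<close> for all \<open>y\<close>. By rotation invariance of the Gaussian,
  \<open>f_P\<close> depends only on the component \<open>al\<close> along \<open>xbar\<close> and the distance \<open>be\<close> to its line, and the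
  integrand being homogeneous of degree two, integrating out the scale of a planar Gaussian \<open>(x, t x)\<close>
  writes \<open>f_P\<close> as the integral of \<open>\<bar>(al + be t)\<^sup>2 - r\<^sup>2\<bar>\<close> against the density \<open>2 / pi / (1 + t\<^sup>2)\<^sup>2\<close>,
  where \<open>r = norm xbar\<close>. For \<open>be > 0\<close> the gradient is computed with elementary antiderivatives; its
  component orthogonal to \<open>(al, be)\<close> vanishes only if \<open>al = 0\<close>, and then the other component vanishes
  iff \<open>c = be / r\<close> solves the stated equation. On the line of \<open>xbar\<close> a comparison with the minimizers
  \<open>\<plusminus> xbar\<close> suffices.\<close>

section \<open>Rotation invariance of the Gaussian\<close>

text \<open>Some orthogonal map sends \<open>e1\<close> to its axis. Following it by the reflection
  in the hyperplane orthogonal to \<open>n = T e2 - axis j 1\<close> moves \<open>T e2\<close> to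
  the second axis and fixes the first, which is orthogonal to \<open>n\<close>.\<close>

lemma orthogonal_transformation_pair_to_axes:
  fixes e1 e2 :: "real ^ 'd" and i j :: 'd
  assumes "norm e1 = 1" "norm e2 = 1" "e1 \<bullet> e2 = 0" "i \<noteq> j"
  obtains T :: "real ^ 'd \<Rightarrow> real ^ 'd" where "orthogonal_transformation T" "T e1 = axis i 1" "T e2 = axis j 1"
proof -
  obtain T :: "real ^ 'd \<Rightarrow> real ^ 'd" where T: "orthogonal_transformation T" "T e1 = axis i 1"
    by (rule orthogonal_transformation_exists[of e1 "axis i 1"]) (simp add: assms(1), blast)
  define n where "n = T e2 - axis j 1"
  define R where "R = (\<lambda>x. x - (2 * (x \<bullet> n) / (n \<bullet> n)) *\<^sub>R n)"
  have inner_T: "T x \<bullet> T y = x \<bullet> y" for x y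
    using T(1) by (simp add: orthogonal_transformation_def)
  have R: "orthogonal_transformation R"
    unfolding orthogonal_transformation_def
  proof safe
    show "linear R"
      unfolding R_def
      by (intro linearI) (simp_all add: inner_add_left distrib_left add_divide_distrib
          scaleR_add_left scaleR_diff_right)
    show "R v \<bullet> R w = v \<bullet> w" for v w
    proof -
      define p q where "p = 2 * (v \<bullet> n) / (n \<bullet> n)" and "q = 2 * (w \<bullet> n) / (n \<bullet> n)"
      \<comment> \<open>For \<open>n = 0\<close> division by zero yields \<open>q = 0\<close> and
        \<open>R\<close> is the identity, so that case needs no separate reflection.\<close>
      have "q * (n \<bullet> n) = 2 * (w \<bullet> n)"
        by (cases "n = 0") (simp_all add: q_def)
      then have "p * (q * (n \<bullet> n)) = 2 * (p * (w \<bullet> n))" by simp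
      moreover have "p * (w \<bullet> n) = q * (v \<bullet> n)"
        by (simp add: p_def q_def)
      moreover have "R v \<bullet> R w = v \<bullet> w - q * (v \<bullet> n) - (p * (w \<bullet> n) - p * (q * (n \<bullet> n)))"
        unfolding R_def p_def[symmetric] q_def[symmetric]
        by (simp add: inner_diff_left inner_diff_right inner_commute[of n w] right_diff_distrib)
      ultimately show ?thesis by linarith
    qed
  qed
  have "T e2 \<bullet> axis i 1 = 0"
    using inner_T[of e2 e1] T(2) assms(3) by (simp add: inner_commute)
  then have "axis i 1 \<bullet> n = 0"
    using assms(4) by (simp add: n_def inner_diff_right inner_axis_axis inner_commute)
  then have R1: "R (T e1) = axis i 1"
    by (simp add: R_def T(2))
  have "T e2 \<bullet> T e2 = 1"
    unfolding inner_T using assms(2) by (simp add: dot_square_norm)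
  \<comment> \<open>The two unit vectors have equal length, so the reflection coefficient at
    \<open>T e2\<close> is one, and \<open>R\<close> subtracts exactly \<open>n\<close>.\<close>
  then have "2 * (T e2 \<bullet> n) = n \<bullet> n"
    by (simp add: n_def inner_diff_right inner_diff_left inner_axis_axis inner_commute)
  then have R2: "R (T e2) = axis j 1"
    by (cases "n = 0") (auto simp: R_def n_def)
  show thesis
    using that[of "R \<circ> T"] orthogonal_transformation_compose[OF R T(1)] R1 R2 by simp
qed

lemma orthogonal_transformation_measurable:
  fixes T :: "'a::euclidean_space \<Rightarrow> 'a"
  shows "orthogonal_transformation T \<Longrightarrow> T \<in> borel_measurable borel"
  by (intro borel_measurable_continuous_onI linear_continuous_on
      linear_conv_bounded_linear[THEN iffD1] orthogonal_transformation_linear)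

lemma nn_integral_lborel_translate:
  fixes c :: "'a::euclidean_space"
  assumes [measurable]: "f \<in> borel_measurable borel"
  shows "(\<integral>\<^sup>+x. f (c + x) \<partial>lborel) = (\<integral>\<^sup>+x. f x \<partial>lborel)"
proof -
  have "(\<integral>\<^sup>+x. f x \<partial>lborel) = (\<integral>\<^sup>+x. f x \<partial>distr lborel borel ((+) c))"
    by (simp add: lborel_distr_plus)
  also have "\<dots> = (\<integral>\<^sup>+x. f (c + x) \<partial>lborel)"
    by (rule nn_integral_distr) auto
  finally show ?thesis by simp
qed

text \<open>Uniqueness of Haar measure: the double integral of \<open>f (T x) g (T x + y)\<close> is computed in
  both orders, where \<open>g\<close> is the indicator of the unit ball. The value does not depend on \<open>T\<close>.\<close>

lemma nn_integral_lborel_orthogonal_transformation: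
  fixes T :: "'a::euclidean_space \<Rightarrow> 'a"
  assumes T: "orthogonal_transformation T" and [measurable]: "f \<in> borel_measurable borel"
  shows "(\<integral>\<^sup>+x. f (T x) \<partial>lborel) = (\<integral>\<^sup>+x. f x \<partial>lborel)"
proof -
  define g :: "'a \<Rightarrow> ennreal" where "g = indicator (ball 0 1)"
  define V where "V = (\<integral>\<^sup>+x. g x \<partial>lborel)"
  have [measurable]: "g \<in> borel_measurable borel" unfolding g_def by (rule borel_measurable_indicator) simp
  have "V = emeasure lborel (ball (0::'a) 1)" by (simp add: V_def g_def)
  moreover have "emeasure lborel (ball (0::'a) 1) \<noteq> 0"
    using open_not_negligible[of "ball (0::'a) 1"]
    by (auto simp: negligible_iff_null_sets null_sets_def)
  moreover have "emeasure lborel (ball (0::'a) 1) \<noteq> \<infinity>"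
    using emeasure_lborel_ball_finite[of "0::'a" 1] by simp
  \<comment> \<open>Cancelling \<open>V\<close> in \<open>ennreal\<close> requires it to be neither
    zero nor infinite.\<close>
  ultimately have V: "V \<noteq> 0" "V \<noteq> \<infinity>" by simp_all
  have key: "(\<integral>\<^sup>+x. f (U x) \<partial>lborel) * V = V * (\<integral>\<^sup>+y. f (- y) \<partial>lborel)"
    if U: "orthogonal_transformation U" for U :: "'a \<Rightarrow> 'a"
  proof -
    have [measurable]: "U \<in> borel_measurable borel"
      using U by (rule orthogonal_transformation_measurable)
    have shift: "(\<integral>\<^sup>+x. f (U x) * g (U x + y) \<partial>lborel) = (\<integral>\<^sup>+x. f (U x - y) * g (U x) \<partial>lborel)" for y
    proof -
      \<comment> \<open>Translating by the preimage \<open>z\<close> of \<open>y\<close> under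
        \<open>U\<close> moves the shift from \<open>g\<close> to \<open>f\<close>.\<close>
      obtain z where z: "y = U z"
        using orthogonal_transformation_surj[OF U] by (metis surjD)
      have "(\<integral>\<^sup>+x. f (U x) * g (U x + y) \<partial>lborel) = (\<integral>\<^sup>+x. f (U (- z + x)) * g (U (- z + x) + y) \<partial>lborel)"
        by (rule nn_integral_lborel_translate[symmetric, where f = "\<lambda>x. f (U x) * g (U x + y)"]) measurable
      also have "\<dots> = (\<integral>\<^sup>+x. f (U x - y) * g (U x) \<partial>lborel)"
        using orthogonal_transformation_linear[OF U] by (simp add: z linear_diff)
      finally show ?thesis .
    qed
    have "(\<integral>\<^sup>+x. f (U x) \<partial>lborel) * V = (\<integral>\<^sup>+x. f (U x) * (\<integral>\<^sup>+y. g (U x + y) \<partial>lborel) \<partial>lborel)"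
      by (simp add: nn_integral_lborel_translate nn_integral_multc flip: V_def)
    also have "\<dots> = (\<integral>\<^sup>+x. (\<integral>\<^sup>+y. f (U x) * g (U x + y) \<partial>lborel) \<partial>lborel)"
      by (simp add: nn_integral_cmult)
    also have "\<dots> = (\<integral>\<^sup>+y. (\<integral>\<^sup>+x. f (U x) * g (U x + y) \<partial>lborel) \<partial>lborel)"
      by (intro lborel_pair.Fubini'[symmetric]) measurable
    also have "\<dots> = (\<integral>\<^sup>+y. (\<integral>\<^sup>+x. f (U x - y) * g (U x) \<partial>lborel) \<partial>lborel)"
      by (simp add: shift)
    also have "\<dots> = (\<integral>\<^sup>+x. (\<integral>\<^sup>+y. f (U x - y) * g (U x) \<partial>lborel) \<partial>lborel)"
      by (intro lborel_pair.Fubini') measurable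
    also have "\<dots> = (\<integral>\<^sup>+x. (\<integral>\<^sup>+y. f (- y) \<partial>lborel) * g (U x) \<partial>lborel)"
    proof (intro nn_integral_cong)
      fix x
      show "(\<integral>\<^sup>+y. f (U x - y) * g (U x) \<partial>lborel) = (\<integral>\<^sup>+y. f (- y) \<partial>lborel) * g (U x)"
        using nn_integral_lborel_translate[of "\<lambda>y. f (U x - y)" "U x"]
        by (simp add: nn_integral_multc)
    qed
    also have "\<dots> = V * (\<integral>\<^sup>+y. f (- y) \<partial>lborel)"
    proof -
      have "g (U x) = g x" for x
        using orthogonal_transformation_norm[OF U] by (simp add: g_def indicator_def)
      then show ?thesis
        by (simp add: nn_integral_cmult flip: V_def) (simp add: mult.commute)
    qed
    finally show ?thesis .
  qed
  \<comment> \<open>The right-hand side of \<open>key\<close> is free of \<open>U\<close>, so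
    \<open>T\<close> is compared with the identity.\<close>
  have "orthogonal_transformation (\<lambda>x::'a. x)"
    by (simp add: orthogonal_transformation_id)
  from key[OF T] key[OF this] show ?thesis
    using V by (metis ennreal_mult_cancel_left mult.commute infinity_ennreal_def)
qed

section \<open>The Gaussian law and its marginals\<close>

lemma std_gaussian_vector_prob_space: "std_gaussian_vector M a \<Longrightarrow> prob_space M"
  by (simp add: std_gaussian_vector_def)

lemma std_gaussian_vector_measurable:
  "std_gaussian_vector M a \<Longrightarrow> a \<in> borel_measurable M"
  unfolding std_gaussian_vector_def using distributed_measurable by fastforce

lemma std_gaussian_density_measurable[measurable]: "std_gaussian_density \<in> borel_measurable borel"
  unfolding std_gaussian_density_def by measurable

lemma nn_integral_std_gaussian_vector:
  fixes g :: "real ^ 'd \<Rightarrow> ennreal"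
  assumes a: "std_gaussian_vector M a" and [measurable]: "g \<in> borel_measurable borel"
  shows "(\<integral>\<^sup>+\<omega>. g (a \<omega>) \<partial>M) = (\<integral>\<^sup>+x. std_gaussian_density x * g x \<partial>lborel)"
  using a unfolding std_gaussian_vector_def
  by (intro distributed_nn_integral[symmetric]) auto

text \<open>The density sees only the norm, which \<open>T\<close> preserves; the rest is the
  orthogonal change of variables for Lebesgue measure.\<close>

lemma nn_integral_std_gaussian_vector_rotate:
  fixes g :: "real ^ 'd \<Rightarrow> ennreal"
  assumes a: "std_gaussian_vector M a" and T: "orthogonal_transformation T"
    and [measurable]: "g \<in> borel_measurable borel"
  shows "(\<integral>\<^sup>+\<omega>. g (T (a \<omega>)) \<partial>M) = (\<integral>\<^sup>+\<omega>. g (a \<omega>) \<partial>M)"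
proof -
  note [measurable] = orthogonal_transformation_measurable[OF T]
  have "std_gaussian_density (T x) = std_gaussian_density x" for x
    using T by (simp add: std_gaussian_density_def orthogonal_transformation_norm)
  then have "(\<integral>\<^sup>+x. std_gaussian_density x * g (T x) \<partial>lborel) =
      (\<integral>\<^sup>+x. std_gaussian_density (T x) * g (T x) \<partial>lborel)"
    by simp
  also have "\<dots> = (\<integral>\<^sup>+x. std_gaussian_density x * g x \<partial>lborel)"
    by (rule nn_integral_lborel_orthogonal_transformation[OF T,
          where f = "\<lambda>x. std_gaussian_density x * g x"]) measurable
  finally show ?thesis
    using nn_integral_std_gaussian_vector[OF a, of g]
      nn_integral_std_gaussian_vector[OF a, of "\<lambda>x. g (T x)"] by simp
qed

abbreviation std_normal :: "real measure" where
  "std_normal \<equiv> density lborel std_normal_density"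

lemma prod_Basis_vec: "(\<Prod>b\<in>Basis. f b) = (\<Prod>i\<in>UNIV. f (axis i (1::real)))"
  for f :: "real ^ 'd \<Rightarrow> 'b::comm_monoid_mult"
proof -
  have "inj (\<lambda>i::'d. axis i (1::real))"
    by (auto intro!: injI simp: axis_eq_axis)
  moreover have "Basis = range (\<lambda>i::'d. axis i (1::real))"
    by (auto simp: Basis_vec_def)
  ultimately show ?thesis
    unfolding \<open>Basis = _\<close> by (subst prod.reindex) auto
qed

text \<open>The density is a product over coordinates, hence so is the integral of a product of
  coordinate indicators.\<close>

lemma nn_integral_std_gaussian_cylinder:
  fixes a :: "'w \<Rightarrow> real ^ 'd"
  assumes a: "std_gaussian_vector M a" and [measurable]: "\<And>i. A i \<in> sets borel"
  shows "(\<integral>\<^sup>+\<omega>. (\<Prod>i\<in>UNIV. indicator (A i) (a \<omega> $ i) :: ennreal) \<partial>M) = (\<Prod>i\<in>UNIV. emeasure std_normal (A i))"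
proof -
  \<comment> \<open>The product formula for \<open>lborel\<close> is indexed by
    \<open>Basis\<close>, so the sets are carried from indices to basis vectors; \<open>axis\<close>
    is injective, which makes the description unique.\<close>
  define B where "B = (\<lambda>b::real^'d. A (THE i. b = axis i 1))"
  have B: "B (axis i 1) = A i" for i
    by (simp add: B_def axis_eq_axis)
  have Bm[measurable]: "B b \<in> sets borel" for b by (simp add: B_def)
  have "(\<integral>\<^sup>+\<omega>. (\<Prod>i\<in>UNIV. indicator (A i) (a \<omega> $ i)) \<partial>M) =
     (\<integral>\<^sup>+x. std_gaussian_density x * (\<Prod>i\<in>UNIV. indicator (A i) (x $ i) :: ennreal) \<partial>lborel)"
    by (rule nn_integral_std_gaussian_vector[OF a, where g = "\<lambda>x. (\<Prod>i\<in>UNIV. indicator (A i) (x $ i))"])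
       measurable
  also have "\<dots> = (\<integral>\<^sup>+x. (\<Prod>b\<in>Basis. ennreal (std_normal_density (x \<bullet> b)) * indicator (B b) (x \<bullet> b)) \<partial>lborel)"
    by (simp add: prod_Basis_vec std_gaussian_density_eq_prod prod.distrib prod_ennreal B inner_axis)
  also have "\<dots> = (\<Prod>b\<in>Basis. (\<integral>\<^sup>+x. ennreal (std_normal_density x) * indicator (B b) x \<partial>lborel))"
    by (rule nn_integral_lborel_prod) auto
  also have "\<dots> = (\<Prod>i\<in>UNIV. emeasure std_normal (A i))"
    by (simp add: prod_Basis_vec B emeasure_density)
  finally show ?thesis .
qed

lemma prob_space_std_normal: "prob_space std_normal"
  by (rule prob_space_normal_density) simp

lemma emeasure_std_normal_UNIV: "emeasure std_normal UNIV = 1"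
  using prob_space.emeasure_space_1[OF prob_space_std_normal] by simp

text \<open>Rotating \<open>e\<close> to a coordinate axis turns the preimage of \<open>A\<close>
  into a cylinder whose other factors have mass one.\<close>

lemma distr_std_gaussian_inner:
  fixes a :: "'w \<Rightarrow> real ^ 'd"
  assumes a: "std_gaussian_vector M a" and e: "norm e = 1"
  shows "distr M borel (\<lambda>\<omega>. a \<omega> \<bullet> e) = std_normal"
proof (rule measure_eqI)
  fix A assume "A \<in> sets (distr M borel (\<lambda>\<omega>. a \<omega> \<bullet> e))"
  then have A[measurable]: "A \<in> sets borel" by simp
  note [measurable] = std_gaussian_vector_measurable[OF a]
  fix i :: 'd
  obtain T :: "real ^ 'd \<Rightarrow> real ^ 'd" where T: "orthogonal_transformation T" "T e = axis i 1"
    by (rule orthogonal_transformation_exists[of e "axis i 1"]) (simp add: e, blast)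
  have Ti: "T x $ i = x \<bullet> e" for x
    using T by (metis inner_axis inner_real_def mult.right_neutral orthogonal_transformation_def)
  have "emeasure (distr M borel (\<lambda>\<omega>. a \<omega> \<bullet> e)) A = (\<integral>\<^sup>+\<omega>. indicator A (T (a \<omega>) $ i) \<partial>M)"
    by (subst emeasure_distr) (auto simp: Ti simp flip: nn_integral_indicator
         intro!: nn_integral_cong split: split_indicator)
  also have "\<dots> = (\<integral>\<^sup>+\<omega>. indicator A (a \<omega> $ i) \<partial>M)"
    by (rule nn_integral_std_gaussian_vector_rotate[OF a T(1), where g = "\<lambda>x. indicator A (x $ i)"]) measurable
  also have "\<dots> = (\<integral>\<^sup>+\<omega>. (\<Prod>k\<in>UNIV. indicator (if k = i then A else UNIV) (a \<omega> $ k)) \<partial>M)"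
    by (simp add: if_distrib[of indicator] if_distribR prod.If_cases)
  also have "\<dots> = (\<Prod>k\<in>UNIV. emeasure std_normal (if k = i then A else UNIV))"
    by (rule nn_integral_std_gaussian_cylinder[OF a]) auto
  also have "\<dots> = emeasure std_normal A"
    by (simp add: if_distrib prod.If_cases emeasure_std_normal_UNIV)
  finally show "emeasure (distr M borel (\<lambda>\<omega>. a \<omega> \<bullet> e)) A = emeasure std_normal A" .
qed simp

text \<open>A product measure is determined by its values on rectangles, and after rotating both
  vectors to axes a rectangle is again a cylinder.\<close>

lemma distr_std_gaussian_inner_pair:
  fixes a :: "'w \<Rightarrow> real ^ 'd"
  assumes a: "std_gaussian_vector M a" and e: "norm e1 = 1" "norm e2 = 1" "e1 \<bullet> e2 = 0"
  shows "distr M (borel \<Otimes>\<^sub>M borel) (\<lambda>\<omega>. (a \<omega> \<bullet> e1, a \<omega> \<bullet> e2)) = std_normal \<Otimes>\<^sub>M std_normal"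
proof (rule pair_measure_eqI[symmetric])
  show "sigma_finite_measure std_normal" "sigma_finite_measure std_normal"
    using prob_space_std_normal by (auto intro: prob_space_imp_sigma_finite)
  fix A B assume "A \<in> sets std_normal" "B \<in> sets std_normal"
  then have [measurable]: "A \<in> sets borel" "B \<in> sets borel" by simp_all
  note [measurable] = std_gaussian_vector_measurable[OF a]
  \<comment> \<open>In dimension one two unit vectors cannot be orthogonal, so two distinct indices
    exist.\<close>
  obtain i j :: 'd where ij: "i \<noteq> j"
  proof (cases "\<exists>i j :: 'd. i \<noteq> j")
    case False
    then have "\<And>i j :: 'd. i = j" by blast
    then have U: "(UNIV :: 'd set) = {i}" for i by blast
    have "e1 \<bullet> e2 = e1 $ i * e2 $ i" for i
      unfolding inner_vec_def U[of i] by simp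
    moreover have "norm e1 = \<bar>e1 $ i\<bar>" "norm e2 = \<bar>e2 $ i\<bar>" for i
      unfolding norm_vec_def L2_set_def U[of i] by simp_all
    ultimately show ?thesis using e by (metis abs_0 mult_eq_0_iff zero_neq_one)
  qed auto
  obtain T :: "real ^ 'd \<Rightarrow> real ^ 'd" where T: "orthogonal_transformation T" "T e1 = axis i 1" "T e2 = axis j 1"
    using orthogonal_transformation_pair_to_axes[OF e ij] by blast
  have Ti: "T x $ i = x \<bullet> e1" and Tj: "T x $ j = x \<bullet> e2" for x
    using T by (metis inner_axis inner_real_def mult.right_neutral orthogonal_transformation_def)+
  have "emeasure (distr M (borel \<Otimes>\<^sub>M borel) (\<lambda>\<omega>. (a \<omega> \<bullet> e1, a \<omega> \<bullet> e2))) (A \<times> B) =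
     (\<integral>\<^sup>+\<omega>. indicator A (T (a \<omega>) $ i) * indicator B (T (a \<omega>) $ j) \<partial>M)"
    by (subst emeasure_distr) (auto simp: Ti Tj simp flip: nn_integral_indicator
         intro!: nn_integral_cong split: split_indicator)
  also have "\<dots> = (\<integral>\<^sup>+\<omega>. indicator A (a \<omega> $ i) * indicator B (a \<omega> $ j) \<partial>M)"
    by (rule nn_integral_std_gaussian_vector_rotate[OF a T(1),
          where g = "\<lambda>x. indicator A (x $ i) * indicator B (x $ j)"]) measurable
  also have "\<dots> = (\<integral>\<^sup>+\<omega>. (\<Prod>k\<in>UNIV. indicator (if k = i then A else if k = j then B else UNIV) (a \<omega> $ k)) \<partial>M)"
    using ij
    by (intro nn_integral_cong, subst prod.subset_diff[of "{i, j}"])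
       (auto intro!: prod.neutral[symmetric] simp: mult.assoc)
  also have "\<dots> = (\<Prod>k\<in>UNIV. emeasure std_normal (if k = i then A else if k = j then B else UNIV))"
    by (rule nn_integral_std_gaussian_cylinder[OF a]) auto
  also have "\<dots> = emeasure std_normal A * emeasure std_normal B"
    using ij
    by (subst prod.subset_diff[of "{i, j}"]) (auto intro!: prod.neutral simp: emeasure_std_normal_UNIV)
  finally show "emeasure std_normal A * emeasure std_normal B =
    emeasure (distr M (borel \<Otimes>\<^sub>M borel) (\<lambda>\<omega>. (a \<omega> \<bullet> e1, a \<omega> \<bullet> e2))) (A \<times> B)" by simp
qed (simp cong: sets_pair_measure_cong)

section \<open>Integrating out the scale of a planar Gaussian\<close>

text \<open>If \<open>x\<close> and \<open>y\<close> are independent standard normal variables, this is the density of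
  \<open>y / x\<close> under the probability measure reweighted by \<open>x\<^sup>2\<close>.\<close>

definition slope_density :: "real \<Rightarrow> real" where
  "slope_density t = 2 / pi / (1 + t\<^sup>2)\<^sup>2"

lemma slope_density_nonneg: "0 \<le> slope_density t"
  by (simp add: slope_density_def)

lemma slope_density_measurable[measurable]: "slope_density \<in> borel_measurable borel"
  unfolding slope_density_def by measurable

text \<open>The exponents combine into a Gaussian in \<open>s * x\<close> with
  \<open>s = sqrt (1 + t^2)\<close>, leaving a third absolute moment scaled by powers of
  \<open>s\<close>. The exponent 3 is the degree two of the integrand plus one from the Jacobian of
  \<open>y = x * t\<close>.\<close>

lemma nn_integral_std_normal_slope:
  "(\<integral>\<^sup>+x. ennreal (\<bar>x\<bar> ^ 3 * (std_normal_density x * std_normal_density (x * t))) \<partial>lborel) = slope_density t"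
proof -
  define s where "s = sqrt (1 + t\<^sup>2)"
  have s2: "s\<^sup>2 = 1 + t\<^sup>2" and s0: "s > 0"
    by (simp_all add: s_def add_pos_nonneg)
  have eq: "\<bar>x\<bar> ^ 3 * (std_normal_density x * std_normal_density (x * t))
     = 1 / (sqrt (2 * pi) * s ^ 3) * (std_normal_density (s * x) * \<bar>s * x\<bar> ^ 3)" for x
  proof -
    have "std_normal_density x * std_normal_density (x * t) =
        1 / sqrt (2 * pi) * (1 / sqrt (2 * pi) * (exp (- x\<^sup>2 / 2) * exp (- (x * t)\<^sup>2 / 2)))"
      by (simp add: std_normal_density_def)
    also have "exp (- x\<^sup>2 / 2) * exp (- (x * t)\<^sup>2 / 2) = exp (- (s * x)\<^sup>2 / 2)"
      unfolding exp_add[symmetric] by (simp add: power_mult_distrib s2 field_simps)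
    finally have "std_normal_density x * std_normal_density (x * t) = 1 / sqrt (2 * pi) * std_normal_density (s * x)"
      by (simp add: std_normal_density_def)
    then show ?thesis
      using s0 by (simp add: abs_mult power_mult_distrib)
  qed
  \<comment> \<open>The third absolute moment of a standard normal variable.\<close>
  define C where "C = sqrt (2 / pi) * 2"
  have "has_bochner_integral lborel (\<lambda>x. std_normal_density x * \<bar>x\<bar> ^ 3) C"
    using std_normal_moment_abs_odd[of 1] by (simp add: C_def numeral_3_eq_3)
  then have "has_bochner_integral lborel (\<lambda>x. std_normal_density (s * x) * \<bar>s * x\<bar> ^ 3) (C / s)"
    using lborel_has_bochner_integral_real_affine_iff[of s "\<lambda>x. std_normal_density x * \<bar>x\<bar> ^ 3" C 0] s0
    by (simp add: divide_inverse mult.commute)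
  then have hb: "has_bochner_integral lborel (\<lambda>x. 1 / (sqrt (2 * pi) * s ^ 3) * (std_normal_density (s * x) * \<bar>s * x\<bar> ^ 3))
     (1 / (sqrt (2 * pi) * s ^ 3) * (C / s))"
    by (rule has_bochner_integral_mult_right)
  have "1 / (sqrt (2 * pi) * s ^ 3) * (C / s) = slope_density t"
  proof -
    have "s ^ 3 * s = (1 + t\<^sup>2)\<^sup>2"
      unfolding s2[symmetric] by (simp add: power2_eq_square power3_eq_cube)
    moreover have "sqrt (2 / pi) * 2 / sqrt (2 * pi) = 2 / pi"
      by (simp add: real_sqrt_mult real_sqrt_divide field_simps)
    ultimately show ?thesis
      by (simp add: slope_density_def C_def mult.assoc divide_simps)
  qed
  with hb show ?thesis
    unfolding eq
    by (subst nn_integral_eq_integral)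
      (auto simp: has_bochner_integral_iff s0 less_imp_le)
qed

text \<open>The substitution \<open>y = x t\<close> integrates out the scale of a function that is homogeneous
  of degree two.\<close>

lemma nn_integral_std_normal_pair_homogeneous:
  fixes F :: "real \<Rightarrow> real \<Rightarrow> real"
  assumes [measurable]: "(\<lambda>(x, y). F x y) \<in> borel_measurable (borel \<Otimes>\<^sub>M borel)"
    and hom: "\<And>s x y. F (s * x) (s * y) = s\<^sup>2 * F x y"
    and nonneg: "\<And>x y. 0 \<le> F x y"
  shows "(\<integral>\<^sup>+z. ennreal (F (fst z) (snd z)) \<partial>(std_normal \<Otimes>\<^sub>M std_normal))
    = (\<integral>\<^sup>+t. ennreal (slope_density t * F 1 t) \<partial>lborel)"
proof -
  have nd: "0 \<le> std_normal_density x" for x by simp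
  interpret N: prob_space std_normal by (rule prob_space_std_normal)
  have "(\<integral>\<^sup>+z. ennreal (F (fst z) (snd z)) \<partial>(std_normal \<Otimes>\<^sub>M std_normal))
     = (\<integral>\<^sup>+x. (\<integral>\<^sup>+y. ennreal (F x y) \<partial>std_normal) \<partial>std_normal)"
    by (subst N.nn_integral_fst[symmetric]) (auto simp: case_prod_beta')
  also have "\<dots> = (\<integral>\<^sup>+x. (\<integral>\<^sup>+y. ennreal (std_normal_density x * (std_normal_density y * F x y)) \<partial>lborel) \<partial>lborel)"
    by (simp add: nn_integral_density ennreal_mult nn_integral_cmult nonneg)
  also have "\<dots> = (\<integral>\<^sup>+x. (\<integral>\<^sup>+t. ennreal (\<bar>x\<bar> ^ 3 * (std_normal_density x * std_normal_density (x * t)) * F 1 t) \<partial>lborel) \<partial>lborel)"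
  \<comment> \<open>The substitution is invalid at \<open>x = 0\<close>, which is a null
    set.\<close>
  proof (rule nn_integral_cong_AE, rule AE_mp[OF AE_lborel_singleton[of 0]], intro AE_I2 impI)
    fix x :: real
    assume x: "x \<noteq> 0"
    have "(\<integral>\<^sup>+y. ennreal (std_normal_density x * (std_normal_density y * F x y)) \<partial>lborel)
       = ennreal \<bar>x\<bar> * (\<integral>\<^sup>+t. ennreal (std_normal_density x * (std_normal_density (0 + x * t) * F x (0 + x * t))) \<partial>lborel)"
      by (rule nn_integral_real_affine) (use x in \<open>auto intro!: measurable_compose[OF _ assms(1)]\<close>)
    also have "\<dots> = (\<integral>\<^sup>+t. ennreal \<bar>x\<bar> * ennreal (std_normal_density x * (std_normal_density (x * t) * F x (x * t))) \<partial>lborel)"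
      by (subst nn_integral_cmult) auto
    also have "\<dots> = (\<integral>\<^sup>+t. ennreal (\<bar>x\<bar> ^ 3 * (std_normal_density x * std_normal_density (x * t)) * F 1 t) \<partial>lborel)"
    proof (rule nn_integral_cong)
      fix t
      have "F x (x * t) = \<bar>x\<bar>\<^sup>2 * F 1 t"
        using hom[of x 1 t] by simp
      then show "ennreal \<bar>x\<bar> * ennreal (std_normal_density x * (std_normal_density (x * t) * F x (x * t)))
        = ennreal (\<bar>x\<bar> ^ 3 * (std_normal_density x * std_normal_density (x * t)) * F 1 t)"
        by (subst ennreal_mult[symmetric])
           (auto simp: nonneg power2_eq_square power3_eq_cube intro!: mult_nonneg_nonneg)
    qed
    finally show "(\<integral>\<^sup>+y. ennreal (std_normal_density x * (std_normal_density y * F x y)) \<partial>lborel) = \<dots>" .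
  qed
  \<comment> \<open>Tonelli puts the scale \<open>x\<close> inside, where
    \<open>nn_integral_std_normal_slope\<close> integrates it out at fixed slope
    \<open>t\<close>.\<close>
  also have "\<dots> = (\<integral>\<^sup>+t. (\<integral>\<^sup>+x. ennreal (\<bar>x\<bar> ^ 3 * (std_normal_density x * std_normal_density (x * t)) * F 1 t) \<partial>lborel) \<partial>lborel)"
    by (intro lborel_pair.Fubini') measurable
  also have "\<dots> = (\<integral>\<^sup>+t. ennreal (slope_density t * F 1 t) \<partial>lborel)"
  proof (rule nn_integral_cong)
    fix t
    have "(\<integral>\<^sup>+x. ennreal (\<bar>x\<bar> ^ 3 * (std_normal_density x * std_normal_density (x * t)) * F 1 t) \<partial>lborel)
      = (\<integral>\<^sup>+x. ennreal (\<bar>x\<bar> ^ 3 * (std_normal_density x * std_normal_density (x * t))) * ennreal (F 1 t) \<partial>lborel)"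
      by (intro nn_integral_cong ennreal_mult nonneg) simp
    also have "\<dots> = ennreal (slope_density t) * ennreal (F 1 t)"
      by (subst nn_integral_multc) (simp_all only: nn_integral_std_normal_slope, measurable)
    also have "\<dots> = ennreal (slope_density t * F 1 t)"
      by (simp add: ennreal_mult nonneg slope_density_nonneg)
    finally show "(\<integral>\<^sup>+x. ennreal (\<bar>x\<bar> ^ 3 * (std_normal_density x * std_normal_density (x * t)) * F 1 t) \<partial>lborel)
      = ennreal (slope_density t * F 1 t)" .
  qed
  finally show ?thesis .
qed

lemma nn_integral_gaussian_homogeneous:
  fixes a :: "'w \<Rightarrow> real ^ 'd" and F :: "real \<Rightarrow> real \<Rightarrow> real"
  assumes a: "std_gaussian_vector M a" and e: "norm e1 = 1" "norm e2 = 1" "e1 \<bullet> e2 = 0"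
    and F[measurable]: "(\<lambda>(x, y). F x y) \<in> borel_measurable (borel \<Otimes>\<^sub>M borel)"
    and hom: "\<And>s x y. F (s * x) (s * y) = s\<^sup>2 * F x y"
    and nonneg: "\<And>x y. 0 \<le> F x y"
  shows "(\<integral>\<^sup>+\<omega>. ennreal (F (a \<omega> \<bullet> e1) (a \<omega> \<bullet> e2)) \<partial>M) = (\<integral>\<^sup>+t. ennreal (slope_density t * F 1 t) \<partial>lborel)"
proof -
  note [measurable] = std_gaussian_vector_measurable[OF a]
  have "(\<integral>\<^sup>+\<omega>. ennreal (F (a \<omega> \<bullet> e1) (a \<omega> \<bullet> e2)) \<partial>M) =
      (\<integral>\<^sup>+z. ennreal (F (fst z) (snd z)) \<partial>distr M (borel \<Otimes>\<^sub>M borel) (\<lambda>\<omega>. (a \<omega> \<bullet> e1, a \<omega> \<bullet> e2)))"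
    by (subst nn_integral_distr) (auto intro!: measurable_compose[OF _ F] simp: case_prod_beta')
  then show ?thesis
    using nn_integral_std_normal_pair_homogeneous[OF F hom nonneg]
    by (simp add: distr_std_gaussian_inner_pair[OF a e])
qed

section \<open>Moments of the slope measure\<close>

definition slope_measure :: "real measure" where
  "slope_measure = density lborel slope_density"

lemma sets_slope_measure[measurable_cong]: "sets slope_measure = sets borel"
  by (simp add: slope_measure_def)

lemma space_slope_measure[simp]: "space slope_measure = UNIV"
  by (simp add: slope_measure_def)

lemma nn_integral_slope_measure:
  assumes [measurable]: "g \<in> borel_measurable borel" and "\<And>t. 0 \<le> g t"
  shows "(\<integral>\<^sup>+t. ennreal (g t) \<partial>slope_measure) = (\<integral>\<^sup>+t. ennreal (slope_density t * g t) \<partial>lborel)"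
  using assms(2) by (simp add: slope_measure_def nn_integral_density ennreal_mult slope_density_nonneg)

lemma nn_integral_std_normal_square: "(\<integral>\<^sup>+x. ennreal (x\<^sup>2) \<partial>std_normal) = 1"
proof -
  have "has_bochner_integral lborel (\<lambda>x. std_normal_density x * x\<^sup>2) 1"
    using std_normal_moment_even[of 1] by simp
  then have "(\<integral>\<^sup>+x. ennreal (std_normal_density x * x\<^sup>2) \<partial>lborel) = 1"
    by (subst nn_integral_eq_integral) (auto simp: has_bochner_integral_iff)
  then show ?thesis
    by (simp add: nn_integral_density ennreal_mult)
qed

text \<open>The homogeneous formula is read backwards with \<open>F x y = x^2\<close>: the total
  mass is the second moment of a standard normal variable.\<close>

lemma prob_space_slope_measure: "prob_space slope_measure"
proof
  interpret N: prob_space std_normal by (rule prob_space_std_normal)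
  have "(\<integral>\<^sup>+t. ennreal 1 \<partial>slope_measure) = (\<integral>\<^sup>+z. ennreal ((fst z)\<^sup>2) \<partial>(std_normal \<Otimes>\<^sub>M std_normal))"
    by (subst nn_integral_std_normal_pair_homogeneous[where F = "\<lambda>x y. x\<^sup>2"], measurable)
       (auto simp: power_mult_distrib nn_integral_slope_measure[where g = "\<lambda>_. 1", simplified])
  also have "\<dots> = (\<integral>\<^sup>+x. (\<integral>\<^sup>+y. ennreal (x\<^sup>2) \<partial>std_normal) \<partial>std_normal)"
    by (subst N.nn_integral_fst[symmetric]) auto
  also have "\<dots> = 1"
    using nn_integral_std_normal_square N.emeasure_space_1 by simp
  finally show "emeasure slope_measure (space slope_measure) = 1" by simp
qed

text \<open>The same device with \<open>F x y = y^2\<close>.\<close>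

lemma has_bochner_integral_slope_square: "has_bochner_integral slope_measure (\<lambda>t. t\<^sup>2) 1"
proof -
  interpret N: prob_space std_normal by (rule prob_space_std_normal)
  have "(\<integral>\<^sup>+t. ennreal (t\<^sup>2) \<partial>slope_measure) = (\<integral>\<^sup>+z. ennreal ((snd z)\<^sup>2) \<partial>(std_normal \<Otimes>\<^sub>M std_normal))"
    by (subst nn_integral_std_normal_pair_homogeneous[where F = "\<lambda>x y. y\<^sup>2"], measurable)
       (auto simp: power_mult_distrib nn_integral_slope_measure)
  also have "\<dots> = (\<integral>\<^sup>+x. (\<integral>\<^sup>+y. ennreal (y\<^sup>2) \<partial>std_normal) \<partial>std_normal)"
    by (subst N.nn_integral_fst[symmetric]) auto
  also have "\<dots> = 1"
    using nn_integral_std_normal_square N.emeasure_space_1 by simp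
  finally show ?thesis
    by (intro has_bochner_integral_nn_integral) auto
qed

lemma integrable_slope_affine_mult [simp]:
  "integrable slope_measure (\<lambda>t. (p + q * t) * (p' + q' * t))"
proof -
  interpret prob_space slope_measure by (rule prob_space_slope_measure)
  have sq: "integrable slope_measure (\<lambda>t. t\<^sup>2)"
    using has_bochner_integral_slope_square by (rule integrable.intros)
  \<comment> \<open>The first moment is dominated by the mass and the second moment.\<close>
  have le: "\<bar>t\<bar> \<le> 1 + t\<^sup>2" for t :: real
  proof -
    have "0 \<le> (\<bar>t\<bar> - 1)\<^sup>2" by simp
    also have "(\<bar>t\<bar> - 1)\<^sup>2 = t\<^sup>2 - 2 * \<bar>t\<bar> + 1" by (simp add: power2_diff)
    finally show ?thesis using zero_le_power2[of t] by linarith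
  qed
  have "integrable slope_measure (\<lambda>t. 1 + t\<^sup>2)"
    using sq by simp
  then have "integrable slope_measure (\<lambda>t. t)"
  proof (rule Bochner_Integration.integrable_bound)
    show "AE t in slope_measure. norm t \<le> norm (1 + t\<^sup>2)"
      by (rule AE_I2) (metis abs_ge_self le order_trans real_norm_def)
  qed simp
  then have "integrable slope_measure (\<lambda>t. p * p' + (p * q' + q * p') * t + q * q' * t\<^sup>2)"
    using sq by simp
  moreover have "(\<lambda>t. (p + q * t) * (p' + q' * t)) = (\<lambda>t. p * p' + (p * q' + q * p') * t + q * q' * t\<^sup>2)"
    by (rule ext) (simp add: algebra_simps power2_eq_square)
  ultimately show ?thesis
    by simp
qed

text \<open>The density is even, so the reflection of \<open>t\<close> negates the integral.\<close>

lemma integral_slope_ident: "(\<integral>t. t \<partial>slope_measure) = 0"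
proof -
  have "(\<integral>t. t \<partial>slope_measure) = (\<integral>t. slope_density t * t \<partial>lborel)"
    unfolding slope_measure_def by (subst integral_density) (auto simp: slope_density_nonneg)
  also have "\<dots> = (\<integral>t. slope_density (- t) * (- t) \<partial>lborel)"
    using lborel_integral_real_affine[of "-1" "\<lambda>t. slope_density t * t" 0] by simp
  also have "\<dots> = - (\<integral>t. slope_density t * t \<partial>lborel)"
    by (simp add: slope_density_def)
  also have "(\<integral>t. slope_density t * t \<partial>lborel) = (\<integral>t. t \<partial>slope_measure)"
    unfolding slope_measure_def by (subst integral_density) (auto simp: slope_density_nonneg)
  finally show ?thesis by simp
qed

text \<open>Mass one, mean zero and second moment one make \<open>1\<close> and \<open>t\<close>
  orthonormal, so affine functions pair like their coefficient vectors.\<close>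

lemma integral_slope_affine_mult:
  "(\<integral>t. (p + q * t) * (p' + q' * t) \<partial>slope_measure) = p * p' + q * q'"
proof -
  interpret prob_space slope_measure by (rule prob_space_slope_measure)
  have int: "integrable slope_measure (\<lambda>t. t\<^sup>2)" "integrable slope_measure (\<lambda>t. t)"
    using integrable_slope_affine_mult[of 0 1 0 1] integrable_slope_affine_mult[of 0 1 1 0]
    by (simp_all add: power2_eq_square)
  have "(\<integral>t. (p + q * t) * (p' + q' * t) \<partial>slope_measure) = (\<integral>t. p * p' + (p * q' + q * p') * t + q * q' * t\<^sup>2 \<partial>slope_measure)"
    by (rule Bochner_Integration.integral_cong) (auto simp: algebra_simps power2_eq_square)
  also have "\<dots> = p * p' + q * q' * (\<integral>t. t\<^sup>2 \<partial>slope_measure)"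
    using int by (simp add: prob_space[simplified] integral_slope_ident)
  also have "(\<integral>t. t\<^sup>2 \<partial>slope_measure) = 1"
    using has_bochner_integral_slope_square by (rule has_bochner_integral_integral_eq)
  finally show ?thesis by simp
qed

text \<open>The value of the objective at a point with coordinate \<open>al\<close> along the signal, whose norm
  is \<open>r\<close>, and with distance \<open>\<bar>be\<bar>\<close> from the line spanned by the signal.\<close>

definition planar_objective :: "real \<Rightarrow> real \<Rightarrow> real \<Rightarrow> real" where
  "planar_objective r al be = (\<integral>t. \<bar>(al + be * t)\<^sup>2 - r\<^sup>2\<bar> \<partial>slope_measure)"

lemma planar_objective_collinear: "planar_objective r al 0 = \<bar>al\<^sup>2 - r\<^sup>2\<bar>"
proof -
  interpret prob_space slope_measure by (rule prob_space_slope_measure)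
  show ?thesis by (simp add: planar_objective_def prob_space[simplified])
qed

text \<open>In the Gaussian coordinates along \<open>e1\<close> and \<open>e2\<close> the integrand
  is the degree two function \<open>F\<close>, and \<open>F 1 t\<close> is the integrand of
  \<open>planar_objective\<close>.\<close>

lemma f_P_planar:
  fixes a :: "'w \<Rightarrow> real ^ 'd"
  assumes a: "std_gaussian_vector M a" and e: "norm e1 = 1" "norm e2 = 1" "e1 \<bullet> e2 = 0"
  shows "f_P M a (r *\<^sub>R e1) (al *\<^sub>R e1 + be *\<^sub>R e2) = planar_objective r al be"
proof -
  interpret prob_space M using a by (rule std_gaussian_vector_prob_space)
  note [measurable] = std_gaussian_vector_measurable[OF a]
  define F where "F = (\<lambda>x y::real. \<bar>(al * x + be * y)\<^sup>2 - (r * x)\<^sup>2\<bar>)"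
  have F[measurable]: "(\<lambda>(x, y). F x y) \<in> borel_measurable (borel \<Otimes>\<^sub>M borel)"
    unfolding F_def by measurable
  have nonneg: "0 \<le> F x y" for x y by (simp add: F_def)
  have hom: "F (s * x) (s * y) = s\<^sup>2 * F x y" for s x y
  proof -
    have "(al * (s * x) + be * (s * y))\<^sup>2 - (r * (s * x))\<^sup>2 = s\<^sup>2 * ((al * x + be * y)\<^sup>2 - (r * x)\<^sup>2)"
      by algebra
    then show ?thesis unfolding F_def by (simp add: abs_mult)
  qed
  have "(\<integral>\<^sup>+\<omega>. ennreal (F (a \<omega> \<bullet> e1) (a \<omega> \<bullet> e2)) \<partial>M) = (\<integral>\<^sup>+t. ennreal (F 1 t) \<partial>slope_measure)"
    using nn_integral_gaussian_homogeneous[where F = F, OF a e F hom nonneg]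
      nn_integral_slope_measure[of "F 1"] nonneg by simp
  moreover have "f_P M a (r *\<^sub>R e1) (al *\<^sub>R e1 + be *\<^sub>R e2) = (\<integral>\<omega>. F (a \<omega> \<bullet> e1) (a \<omega> \<bullet> e2) \<partial>M)"
    unfolding f_P_def F_def by (simp add: inner_add_right)
  moreover have "planar_objective r al be = (\<integral>t. F 1 t \<partial>slope_measure)"
    by (simp add: planar_objective_def F_def)
  ultimately show ?thesis
    by (simp add: integral_eq_nn_integral F_def)
qed

section \<open>Second moments and weak convexity\<close>

lemma has_bochner_integral_gaussian_inner_square:
  fixes a :: "'w \<Rightarrow> real ^ 'd"
  assumes a: "std_gaussian_vector M a"
  shows "has_bochner_integral M (\<lambda>\<omega>. (a \<omega> \<bullet> w)\<^sup>2) ((norm w)\<^sup>2)"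
proof (cases "w = 0")
  case False
  note [measurable] = std_gaussian_vector_measurable[OF a]
  define e where "e = w /\<^sub>R norm w"
  have e: "norm e = 1" using False by (simp add: e_def)
  have "(\<integral>\<^sup>+\<omega>. ennreal ((a \<omega> \<bullet> e)\<^sup>2) \<partial>M) = (\<integral>\<^sup>+x. ennreal (x\<^sup>2) \<partial>distr M borel (\<lambda>\<omega>. a \<omega> \<bullet> e))"
    by (subst nn_integral_distr) auto
  then have "(\<integral>\<^sup>+\<omega>. ennreal ((a \<omega> \<bullet> e)\<^sup>2) \<partial>M) = ennreal 1"
    by (simp add: distr_std_gaussian_inner[OF a e] nn_integral_std_normal_square)
  then have "has_bochner_integral M (\<lambda>\<omega>. (a \<omega> \<bullet> e)\<^sup>2) 1"
    by (intro has_bochner_integral_nn_integral) auto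
  then have "has_bochner_integral M (\<lambda>\<omega>. (norm w)\<^sup>2 * (a \<omega> \<bullet> e)\<^sup>2) ((norm w)\<^sup>2 * 1)"
    by (rule has_bochner_integral_mult_right)
  moreover have "(norm w)\<^sup>2 * (a \<omega> \<bullet> e)\<^sup>2 = (a \<omega> \<bullet> w)\<^sup>2" for \<omega>
    using False by (simp add: e_def power_mult_distrib power_inverse)
  ultimately show ?thesis by simp
qed (simp add: has_bochner_integral_zero)

lemma f_P_integrable:
  fixes a :: "'w \<Rightarrow> real ^ 'd"
  assumes a: "std_gaussian_vector M a"
  shows "integrable M (\<lambda>\<omega>. \<bar>(a \<omega> \<bullet> x)\<^sup>2 - (a \<omega> \<bullet> y)\<^sup>2\<bar>)"
  using has_bochner_integral_gaussian_inner_square[OF a]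
  by (intro integrable_abs Bochner_Integration.integrable_diff) (auto simp: has_bochner_integral_iff)

text \<open>Computed from one marginal alone, since in dimension one there is no unit vector
  orthogonal to \<open>e\<close> to which \<open>f_P_planar\<close> could be applied.\<close>

lemma f_P_collinear:
  fixes a :: "'w \<Rightarrow> real ^ 'd"
  assumes a: "std_gaussian_vector M a" and e: "norm e = 1"
  shows "f_P M a (r *\<^sub>R e) (al *\<^sub>R e) = \<bar>al\<^sup>2 - r\<^sup>2\<bar>"
proof -
  have "\<bar>(al * u)\<^sup>2 - (r * u)\<^sup>2\<bar> = \<bar>al\<^sup>2 - r\<^sup>2\<bar> * u\<^sup>2" for u
    by (simp add: power_mult_distrib abs_mult flip: left_diff_distrib)
  then show ?thesis
    using has_bochner_integral_gaussian_inner_square[OF a, of e] e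
    by (simp add: f_P_def has_bochner_integral_iff)
qed

text \<open>This is convexity of the objective plus the squared norm. Pointwise, the square along
  the segment misses its chord by exactly \<open>t * (1 - t) * p^2\<close>; the triangle inequality
  separates the terms, and \<open>p^2\<close> has mean \<open>(norm w)^2\<close>.\<close>

lemma f_P_weakly_convex:
  fixes a :: "'w \<Rightarrow> real ^ 'd"
  assumes a: "std_gaussian_vector M a" and t: "0 \<le> t" "t \<le> 1"
  shows "f_P M a z (x + t *\<^sub>R w) \<le> (1 - t) * f_P M a z x + t * f_P M a z (x + w) + t * (1 - t) * (norm w)\<^sup>2"
proof -
  note int = f_P_integrable[OF a]
  note sq = has_bochner_integral_gaussian_inner_square[OF a, of w]
  have "f_P M a z (x + t *\<^sub>R w) \<le> (\<integral>\<omega>. (1 - t) * \<bar>(a \<omega> \<bullet> x)\<^sup>2 - (a \<omega> \<bullet> z)\<^sup>2\<bar>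
      + t * \<bar>(a \<omega> \<bullet> (x + w))\<^sup>2 - (a \<omega> \<bullet> z)\<^sup>2\<bar> + t * (1 - t) * (a \<omega> \<bullet> w)\<^sup>2 \<partial>M)"
    unfolding f_P_def
  proof (rule integral_mono)
    fix \<omega>
    define u v p where "u = a \<omega> \<bullet> x" and "v = a \<omega> \<bullet> z" and "p = a \<omega> \<bullet> w"
    have "\<bar>(u + t * p)\<^sup>2 - v\<^sup>2\<bar> = \<bar>(1 - t) * (u\<^sup>2 - v\<^sup>2) + t * ((u + p)\<^sup>2 - v\<^sup>2) - t * (1 - t) * p\<^sup>2\<bar>"
      by (rule arg_cong[where f = abs]) algebra
    also have "\<dots> \<le> \<bar>(1 - t) * (u\<^sup>2 - v\<^sup>2)\<bar> + \<bar>t * ((u + p)\<^sup>2 - v\<^sup>2)\<bar> + \<bar>t * (1 - t) * p\<^sup>2\<bar>"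
      by linarith
    also have "\<dots> = (1 - t) * \<bar>u\<^sup>2 - v\<^sup>2\<bar> + t * \<bar>(u + p)\<^sup>2 - v\<^sup>2\<bar> + t * (1 - t) * p\<^sup>2"
      using t by (simp add: abs_mult)
    finally show "\<bar>(a \<omega> \<bullet> (x + t *\<^sub>R w))\<^sup>2 - (a \<omega> \<bullet> z)\<^sup>2\<bar> \<le> (1 - t) * \<bar>(a \<omega> \<bullet> x)\<^sup>2 - (a \<omega> \<bullet> z)\<^sup>2\<bar>
      + t * \<bar>(a \<omega> \<bullet> (x + w))\<^sup>2 - (a \<omega> \<bullet> z)\<^sup>2\<bar> + t * (1 - t) * (a \<omega> \<bullet> w)\<^sup>2"
      by (simp add: u_def v_def p_def inner_add_right)
  qed (use int sq in \<open>auto simp: has_bochner_integral_iff\<close>)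
  also have "\<dots> = (1 - t) * f_P M a z x + t * f_P M a z (x + w) + t * (1 - t) * (norm w)\<^sup>2"
    using int sq by (simp add: f_P_def has_bochner_integral_iff)
  finally show ?thesis .
qed

section \<open>Stationarity of weakly convex functions\<close>

text \<open>The local lower bound is made global: near \<open>x\<close>, on the segment towards
  \<open>y\<close>, it is compared with the chord bound from \<open>conv\<close> and divided by
  \<open>t\<close>.\<close>

lemma frechet_subdiff_weakly_convex:
  fixes f :: "'a::real_inner \<Rightarrow> real"
  assumes conv: "\<And>x w t. 0 \<le> t \<Longrightarrow> t \<le> 1 \<Longrightarrow>
      f (x + t *\<^sub>R w) \<le> (1 - t) * f x + t * f (x + w) + t * (1 - t) * (norm w)\<^sup>2"
    and v: "v \<in> frechet_subdiff f x"
  shows "f x + v \<bullet> (y - x) \<le> f y + (norm (y - x))\<^sup>2"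
proof (cases "y = x")
  case False
  define w where "w = y - x"
  have w: "w \<noteq> 0" "y = x + w" using False by (simp_all add: w_def)
  from v obtain r where r: "r \<in> o[at x](\<lambda>y. norm (y - x))"
    and fr: "\<forall>\<^sub>F y in at x. f y \<ge> f x + v \<bullet> (y - x) + r y"
    by (auto simp: frechet_subdiff_def)
  have bound: "v \<bullet> w \<le> f y - f x + (norm w)\<^sup>2 + e * norm w" if e: "e > 0" for e
  proof -
    have "\<forall>\<^sub>F y in at x. norm (r y) \<le> e * norm (norm (y - x))"
      using r e by (rule landau_o.smallD)
    with fr have ev: "\<forall>\<^sub>F y in at x. f x + v \<bullet> (y - x) - e * norm (y - x) \<le> f y"
      by eventually_elim auto
    \<comment> \<open>The neighbourhood statement at \<open>x\<close> is pulled back along the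
      segment.\<close>
    have "((\<lambda>t. x + t *\<^sub>R w) \<longlongrightarrow> x + 0 *\<^sub>R w) (at_right 0)"
      by (intro tendsto_intros)
    moreover have "\<forall>\<^sub>F t in at_right 0. x + t *\<^sub>R w \<noteq> x"
      using w by (auto simp: eventually_at_filter)
    ultimately have "filterlim (\<lambda>t. x + t *\<^sub>R w) (at x) (at_right 0)"
      by (simp add: filterlim_at)
    from eventually_compose_filterlim[OF ev this]
    have "\<forall>\<^sub>F t in at_right 0. f x + v \<bullet> (t *\<^sub>R w) - e * norm (t *\<^sub>R w) \<le> f (x + t *\<^sub>R w)"
      by simp
    moreover have "\<forall>\<^sub>F t in at_right (0::real). 0 < t \<and> t < 1"
      using eventually_at_right_real[of 0 "1::real"] by (simp add: greaterThanLessThan_iff)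
    ultimately have "\<forall>\<^sub>F t in at_right (0::real). 0 < t \<and> t < 1 \<and>
        f x + v \<bullet> (t *\<^sub>R w) - e * norm (t *\<^sub>R w) \<le> f (x + t *\<^sub>R w)"
      by eventually_elim auto
    then obtain t where t: "0 < t" "t < 1"
      and "f x + v \<bullet> (t *\<^sub>R w) - e * norm (t *\<^sub>R w) \<le> f (x + t *\<^sub>R w)"
      using eventually_happens'[OF trivial_limit_at_right_real[of "0::real"]] by blast
    moreover have "f (x + t *\<^sub>R w) \<le> (1 - t) * f x + t * f y + t * (1 - t) * (norm w)\<^sup>2"
      using conv[of t x w] t w by simp
    ultimately have "t * (v \<bullet> w) \<le> t * (f y - f x + (1 - t) * (norm w)\<^sup>2 + e * norm w)"
      using t by (simp add: algebra_simps)
    then have "v \<bullet> w \<le> f y - f x + (1 - t) * (norm w)\<^sup>2 + e * norm w"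
      using t by simp
    also have "(1 - t) * (norm w)\<^sup>2 \<le> 1 * (norm w)\<^sup>2"
      using t by (intro mult_right_mono) auto
    finally show ?thesis by simp
  qed
  \<comment> \<open>Rescaling by \<open>norm w\<close> turns the error into a plain additive
    epsilon.\<close>
  have "v \<bullet> w \<le> f y - f x + (norm w)\<^sup>2 + e" if "e > 0" for e
    using bound[of "e / norm w"] that w(1) by simp
  then have "v \<bullet> w \<le> f y - f x + (norm w)\<^sup>2"
    by (rule field_le_epsilon)
  then show ?thesis by (simp add: w_def)
qed simp

text \<open>The global subgradient inequality is closed under limits of points, values and
  subgradients. Conversely, the quadratic term is an admissible Frechet remainder, and constant
  sequences witness the limit.\<close>

lemma stationary_weakly_convex_iff:
  fixes f :: "'a::real_inner \<Rightarrow> real"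
  assumes conv: "\<And>x w t. 0 \<le> t \<Longrightarrow> t \<le> 1 \<Longrightarrow>
      f (x + t *\<^sub>R w) \<le> (1 - t) * f x + t * f (x + w) + t * (1 - t) * (norm w)\<^sup>2"
  shows "stationary f x \<longleftrightarrow> (\<forall>y. f x \<le> f y + (norm (y - x))\<^sup>2)"
proof
  assume "stationary f x"
  then obtain X V where XV: "\<And>i. V i \<in> frechet_subdiff f (X i)" "X \<longlonglongrightarrow> x"
      "(\<lambda>i. f (X i)) \<longlonglongrightarrow> f x" "V \<longlonglongrightarrow> 0"
    by (auto simp: stationary_def limiting_subdiff_def)
  show "\<forall>y. f x \<le> f y + (norm (y - x))\<^sup>2"
  proof
    fix y
    have "(\<lambda>i. f (X i) + V i \<bullet> (y - X i)) \<longlonglongrightarrow> f x + 0 \<bullet> (y - x)"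
      by (intro tendsto_intros XV)
    moreover have "(\<lambda>i. f y + (norm (y - X i))\<^sup>2) \<longlonglongrightarrow> f y + (norm (y - x))\<^sup>2"
      by (intro tendsto_intros XV)
    ultimately have "f x + 0 \<bullet> (y - x) \<le> f y + (norm (y - x))\<^sup>2"
      by (rule LIMSEQ_le) (auto intro: frechet_subdiff_weakly_convex[OF conv XV(1)])
    then show "f x \<le> f y + (norm (y - x))\<^sup>2" by simp
  qed
next
  assume *: "\<forall>y. f x \<le> f y + (norm (y - x))\<^sup>2"
  have "(\<lambda>y. - (norm (y - x))\<^sup>2) \<in> o[at x](\<lambda>y. norm (y - x))"
  proof (rule landau_o.smallI)
    fix c :: real assume c: "c > 0"
    have "\<forall>\<^sub>F y in at x. dist y x < c"
      using c by (auto simp: eventually_at)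
    then show "\<forall>\<^sub>F y in at x. norm (- (norm (y - x))\<^sup>2) \<le> c * norm (norm (y - x))"
      by eventually_elim (auto simp: dist_norm power2_eq_square intro: mult_right_mono)
  qed
  then have "0 \<in> frechet_subdiff f x"
    unfolding frechet_subdiff_def using *
    by (intro CollectI exI[of _ "\<lambda>y. - (norm (y - x))\<^sup>2"] conjI always_eventually)
       (auto simp: algebra_simps)
  then show "stationary f x"
    unfolding stationary_def limiting_subdiff_def
    by (intro CollectI exI[of _ "\<lambda>_. x"] exI[of _ "\<lambda>_. 0"]) auto
qed

section \<open>The critical radius\<close>

text \<open>Both differences vanish at zero, and by the finite geometric sum their derivatives are
  \<open>y^10 / (1 + y^2)\<close> and \<open>y^12 / (1 + y^2)\<close>.\<close>

lemma arctan_Taylor_bounds: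
  fixes x :: real
  assumes "0 \<le> x"
  shows "arctan x \<le> x - x^3/3 + x^5/5 - x^7/7 + x^9/9"
    and "x - x^3/3 + x^5/5 - x^7/7 + x^9/9 - x^11/11 \<le> arctan x"
proof -
  define u where "u = (\<lambda>x::real. x - x^3/3 + x^5/5 - x^7/7 + x^9/9 - arctan x)"
  have "u 0 \<le> u x"
  proof (rule DERIV_nonneg_imp_nondecreasing[OF assms])
    fix y :: real
    have "(u has_real_derivative (1 - y^2 + y^4 - y^6 + y^8 - inverse (1 + y\<^sup>2))) (at y)"
      unfolding u_def by (auto intro!: derivative_eq_intros)
    moreover have "1 - y^2 + y^4 - y^6 + y^8 - inverse (1 + y\<^sup>2) = y ^ 10 / (1 + y\<^sup>2)"
      by (simp add: field_simps add_nonneg_eq_0_iff)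
    ultimately show "\<exists>d. (u has_real_derivative d) (at y) \<and> 0 \<le> d"
      by (intro exI conjI) auto
  qed
  then show "arctan x \<le> x - x^3/3 + x^5/5 - x^7/7 + x^9/9"
    by (simp add: u_def)
  define l where "l = (\<lambda>x::real. arctan x - (x - x^3/3 + x^5/5 - x^7/7 + x^9/9 - x^11/11))"
  have "l 0 \<le> l x"
  proof (rule DERIV_nonneg_imp_nondecreasing[OF assms])
    fix y :: real
    have "(l has_real_derivative (inverse (1 + y\<^sup>2) - (1 - y^2 + y^4 - y^6 + y^8 - y^10))) (at y)"
      unfolding l_def by (auto intro!: derivative_eq_intros)
    moreover have "inverse (1 + y\<^sup>2) - (1 - y^2 + y^4 - y^6 + y^8 - y^10) = y ^ 12 / (1 + y\<^sup>2)"
      by (simp add: field_simps add_nonneg_eq_0_iff)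
    ultimately show "\<exists>d. (l has_real_derivative d) (at y) \<and> 0 \<le> d"
      by (intro exI conjI) auto
  qed
  then show "x - x^3/3 + x^5/5 - x^7/7 + x^9/9 - x^11/11 \<le> arctan x"
    by (simp add: l_def)
qed

text \<open>Eliminates \<open>pi\<close> from the numerical estimates and yields an argument small
  enough for the Taylor bounds, by the addition formula for the tangent.\<close>

lemma pi_quarter_minus_arctan:
  fixes c :: real
  assumes "0 < c" "c < 1"
  shows "pi / 4 - arctan c = arctan ((1 - c) / (1 + c))"
proof -
  have "1 + c * c \<noteq> 0" "c + c * c \<noteq> - 1" using assms by (smt (verit) mult_pos_pos)+
  then have "(c + (1 - c) / (1 + c)) / (1 - c * ((1 - c) / (1 + c))) = 1"
    using assms by (simp add: field_simps)
  then show ?thesis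
    using arctan_add[of c "(1 - c) / (1 + c)"] assms by (simp add: arctan_one abs_less_iff field_simps)
qed

text \<open>Uniqueness follows from strict monotonicity: \<open>G\<close> has derivative
  \<open>2 / (1 + t^2)^2\<close>, which is \<open>pi\<close> times \<open>slope_density\<close>.
  Existence and location come from the intermediate value theorem.\<close>

lemma critical_radius:
  obtains c :: real where "c > 0" "\<bar>c - 0.4416\<bar> < 0.00005"
    "\<And>t. pi / 4 = t / (1 + t\<^sup>2) + arctan t \<longleftrightarrow> t = c"
proof -
  define G where "G = (\<lambda>t::real. t / (1 + t\<^sup>2) + arctan t)"
  have nz: "1 + t\<^sup>2 \<noteq> 0" for t :: real
    by (simp add: add_nonneg_eq_0_iff)
  have der: "(G has_real_derivative (2 / (1 + t\<^sup>2)\<^sup>2)) (at t)" for t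
  proof -
    define D where "D = 1 + t\<^sup>2"
    have D: "D \<noteq> 0" using nz[of t] by (simp add: D_def)
    have "(G has_real_derivative ((1 * (1 + t\<^sup>2) - t * (2 * t)) / ((1 + t\<^sup>2) * (1 + t\<^sup>2)) + inverse (1 + t\<^sup>2))) (at t)"
      unfolding G_def by (rule derivative_eq_intros refl nz | simp)+
    also have "(1 * (1 + t\<^sup>2) - t * (2 * t)) / ((1 + t\<^sup>2) * (1 + t\<^sup>2)) + inverse (1 + t\<^sup>2)
        = (2 - D) / (D * D) + inverse D"
      by (simp add: D_def power2_eq_square)
    also have "\<dots> = 2 / D\<^sup>2"
      using D by (simp add: field_simps power2_eq_square)
    finally show ?thesis by (simp add: D_def)
  qed
  have mono: "G s < G t" if "s < t" for s t
  proof (rule DERIV_pos_imp_increasing[OF that])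
    show "\<exists>d. (G has_real_derivative d) (at y) \<and> 0 < d" for y
      using der nz[of y] by (intro exI conjI) (auto simp: zero_less_power2)
  qed
  have inj: "G s = G t \<longleftrightarrow> s = t" for s t
    by (metis mono less_irrefl linorder_neqE_linordered_idom)
  \<comment> \<open>The bracket 0.4416 plus or minus 0.00004 fits strictly inside the required
    tolerance; each end reduces to a rational inequality in \<open>x\<close>.\<close>
  have lower: "G 0.44156 \<le> pi / 4"
  proof -
    define x :: real where "x = (1 - 0.44156) / (1 + 0.44156)"
    have x0: "0 \<le> x" by (simp add: x_def)
    have "0.44156 / (1 + 0.44156\<^sup>2) \<le> x - x^3/3 + x^5/5 - x^7/7 + x^9/9 - x^11/11"
      by (simp add: x_def power_divide)
    moreover have "pi / 4 - arctan 0.44156 = arctan x"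
      unfolding x_def by (rule pi_quarter_minus_arctan) simp_all
    ultimately show ?thesis
      using arctan_Taylor_bounds(2)[of x] unfolding G_def x_def[symmetric] by (smt (verit) x0)
  qed
  have upper: "pi / 4 \<le> G 0.44164"
  proof -
    define x :: real where "x = (1 - 0.44164) / (1 + 0.44164)"
    have x0: "0 \<le> x" by (simp add: x_def)
    have "x - x^3/3 + x^5/5 - x^7/7 + x^9/9 \<le> 0.44164 / (1 + 0.44164\<^sup>2)"
      by (simp add: x_def power_divide)
    moreover have "pi / 4 - arctan 0.44164 = arctan x"
      unfolding x_def by (rule pi_quarter_minus_arctan) simp_all
    ultimately show ?thesis
      using arctan_Taylor_bounds(1)[of x] unfolding G_def x_def[symmetric] by (smt (verit) x0)
  qed
  have "\<exists>c. 0.44156 \<le> c \<and> c \<le> 0.44164 \<and> G c = pi / 4"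
    using der by (intro IVT lower upper) (auto intro!: DERIV_isCont)
  then obtain c where c: "0.44156 \<le> c" "c \<le> 0.44164" "G c = pi / 4" by blast
  show thesis
  proof
    show "c > 0" "\<bar>c - 0.4416\<bar> < 0.00005" using c by (simp_all add: abs_if)
    show "pi / 4 = t / (1 + t\<^sup>2) + arctan t \<longleftrightarrow> t = c" for t
      unfolding c(3)[symmetric] using inj[of t c] unfolding G_def by auto
  qed
qed

section \<open>Critical points of the planar objective\<close>

lemma AE_slope_measure_neq: "AE t in slope_measure. t \<noteq> c"
  unfolding slope_measure_def using AE_lborel_singleton[of c]
  by (subst AE_density) (auto elim: eventually_mono)

text \<open>Half the derivative of \<open>planar_objective r\<close> at \<open>(al, be)\<close> in the direction \<open>(p, q)\<close>,
  for \<open>be \<noteq> 0\<close>.\<close>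

definition slope_pairing :: "real \<Rightarrow> real \<Rightarrow> real \<Rightarrow> real \<Rightarrow> real \<Rightarrow> real" where
  "slope_pairing r al be p q =
     (\<integral>t. sgn ((al + be * t)\<^sup>2 - r\<^sup>2) * ((al + be * t) * (p + q * t)) \<partial>slope_measure)"

lemma integrable_slope_sgn:
  "integrable slope_measure (\<lambda>t. sgn ((al + be * t)\<^sup>2 - r\<^sup>2) * ((p + q * t) * (p' + q' * t)))"
  by (rule Bochner_Integration.integrable_bound[OF integrable_slope_affine_mult[of p q p' q']])
     (auto simp: abs_mult abs_sgn_eq)

lemma integrable_slope_objective: "integrable slope_measure (\<lambda>t. \<bar>(al + be * t)\<^sup>2 - r\<^sup>2\<bar>)"
proof -
  interpret prob_space slope_measure by (rule prob_space_slope_measure)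
  show ?thesis
    using integrable_slope_affine_mult[of al be al be] by (simp add: power2_eq_square)
qed

lemma slope_pairing_linear:
  "slope_pairing r al be p q = p * slope_pairing r al be 1 0 + q * slope_pairing r al be 0 1"
proof -
  define S where "S = (\<lambda>t. sgn ((al + be * t)\<^sup>2 - r\<^sup>2))"
  have int: "integrable slope_measure (\<lambda>t. S t * (al + be * t))"
      "integrable slope_measure (\<lambda>t. S t * ((al + be * t) * t))"
    using integrable_slope_sgn[of al be r al be 1 0] integrable_slope_sgn[of al be r al be 0 1]
    by (simp_all add: S_def)
  have "slope_pairing r al be p q = (\<integral>t. p * (S t * (al + be * t)) + q * (S t * ((al + be * t) * t)) \<partial>slope_measure)"
    unfolding slope_pairing_def
    by (rule Bochner_Integration.integral_cong) (simp_all add: S_def algebra_simps)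
  also have "\<dots> = p * (\<integral>t. S t * (al + be * t) \<partial>slope_measure) + q * (\<integral>t. S t * ((al + be * t) * t) \<partial>slope_measure)"
    using int by simp
  finally show ?thesis by (simp add: slope_pairing_def S_def)
qed

text \<open>The bound \<open>\<bar>s'\<bar> \<ge> sgn s * s'\<close> under the integral.\<close>

lemma planar_objective_ge:
  "planar_objective r al be + 2 * slope_pairing r al be p q - (p\<^sup>2 + q\<^sup>2) \<le> planar_objective r (al + p) (be + q)"
proof -
  define S where "S = (\<lambda>t. sgn ((al + be * t)\<^sup>2 - r\<^sup>2))"
  have "planar_objective r al be + 2 * slope_pairing r al be p q - (p\<^sup>2 + q\<^sup>2) =
     (\<integral>t. \<bar>(al + be * t)\<^sup>2 - r\<^sup>2\<bar> + 2 * (S t * ((al + be * t) * (p + q * t))) - (p + q * t) * (p + q * t) \<partial>slope_measure)"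
    using integrable_slope_sgn[of al be r al be p q] integrable_slope_objective[of al be r]
    by (simp add: S_def integral_slope_affine_mult planar_objective_def slope_pairing_def power2_eq_square)
  also have "\<dots> \<le> planar_objective r (al + p) (be + q)"
    unfolding planar_objective_def
  proof (rule integral_mono)
    fix t
    define c d where "c = al + be * t" and "d = p + q * t"
    have "\<bar>c\<^sup>2 - r\<^sup>2\<bar> + 2 * (S t * (c * d)) - d * d \<le> S t * ((c + d)\<^sup>2 - r\<^sup>2)"
    proof -
      have "\<bar>c\<^sup>2 - r\<^sup>2\<bar> = S t * (c\<^sup>2 - r\<^sup>2)"
        by (simp add: S_def c_def abs_sgn mult.commute)
      moreover have "S t * ((c + d)\<^sup>2 - r\<^sup>2) = S t * (c\<^sup>2 - r\<^sup>2) + 2 * (S t * (c * d)) + S t * (d * d)"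
        by (simp add: algebra_simps power2_eq_square)
      \<comment> \<open>The second order term is at worst \<open>- d * d\<close>, whose integral is
        minus \<open>p^2 + q^2\<close>.\<close>
      moreover have "- 1 * (d * d) \<le> S t * (d * d)"
        by (rule mult_right_mono) (auto simp: S_def sgn_if)
      ultimately show ?thesis by linarith
    qed
    also have "\<dots> \<le> \<bar>S t\<bar> * \<bar>(c + d)\<^sup>2 - r\<^sup>2\<bar>"
      by (metis abs_ge_self abs_mult)
    also have "\<dots> \<le> 1 * \<bar>(c + d)\<^sup>2 - r\<^sup>2\<bar>"
      by (rule mult_right_mono) (auto simp: S_def abs_sgn_eq)
    also have "c + d = al + p + (be + q) * t"
      by (simp add: c_def d_def algebra_simps)
    finally show "\<bar>(al + be * t)\<^sup>2 - r\<^sup>2\<bar> + 2 * (S t * ((al + be * t) * (p + q * t))) - (p + q * t) * (p + q * t)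
      \<le> \<bar>(al + p + (be + q) * t)\<^sup>2 - r\<^sup>2\<bar>"
      by (simp add: c_def d_def)
  qed (use integrable_slope_sgn[of al be r al be p q] integrable_slope_objective in \<open>simp_all add: S_def\<close>)
  finally show ?thesis .
qed

text \<open>Away from the kink the sign \<open>S\<close> persists for small \<open>h n\<close>, so
  the absolute value is eventually \<open>S\<close> times a quadratic polynomial.\<close>

lemma abs_difference_quotient_LIMSEQ:
  fixes c d r :: real
  assumes "c\<^sup>2 \<noteq> r\<^sup>2" and h: "h \<longlonglongrightarrow> 0" "\<And>n. h n \<noteq> 0"
  shows "(\<lambda>n. (\<bar>(c + h n * d)\<^sup>2 - r\<^sup>2\<bar> - \<bar>c\<^sup>2 - r\<^sup>2\<bar>) / h n) \<longlonglongrightarrow> 2 * (sgn (c\<^sup>2 - r\<^sup>2) * (c * d))"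
proof -
  define S where "S = sgn (c\<^sup>2 - r\<^sup>2)"
  have S: "\<bar>c\<^sup>2 - r\<^sup>2\<bar> = S * (c\<^sup>2 - r\<^sup>2)" "\<bar>S\<bar> = 1" "0 < S * (c\<^sup>2 - r\<^sup>2)"
    using assms(1) by (auto simp: S_def sgn_if)
  have "(\<lambda>n. S * ((c + h n * d)\<^sup>2 - r\<^sup>2)) \<longlonglongrightarrow> S * ((c + 0 * d)\<^sup>2 - r\<^sup>2)"
    by (intro tendsto_intros h)
  then have "\<forall>\<^sub>F n in sequentially. 0 < S * ((c + h n * d)\<^sup>2 - r\<^sup>2)"
    using S(3) by (intro order_tendstoD(1)) simp_all
  then have "\<forall>\<^sub>F n in sequentially. S * (2 * (c * d) + h n * d\<^sup>2) = (\<bar>(c + h n * d)\<^sup>2 - r\<^sup>2\<bar> - \<bar>c\<^sup>2 - r\<^sup>2\<bar>) / h n"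
  proof eventually_elim
    case (elim n)
    then have "\<bar>(c + h n * d)\<^sup>2 - r\<^sup>2\<bar> = S * ((c + h n * d)\<^sup>2 - r\<^sup>2)"
      using S(2) by (metis abs_mult abs_of_pos mult_1)
    then have "\<bar>(c + h n * d)\<^sup>2 - r\<^sup>2\<bar> - \<bar>c\<^sup>2 - r\<^sup>2\<bar> = S * (2 * (c * d) + h n * d\<^sup>2) * h n"
      unfolding S(1) by (simp add: algebra_simps power2_eq_square)
    then show ?case using h(2)[of n] by simp
  qed
  moreover have "(\<lambda>n. S * (2 * (c * d) + h n * d\<^sup>2)) \<longlonglongrightarrow> S * (2 * (c * d) + 0 * d\<^sup>2)"
    by (intro tendsto_intros h)
  ultimately show ?thesis
    by (simp add: S_def mult.left_commute Lim_transform_eventually)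
qed

text \<open>By \<open>min\<close>, the difference quotients in direction \<open>(p, q)\<close> are
  at least \<open>- h n * (p^2 + q^2)\<close>; dominated convergence identifies their limit as twice
  the pairing.\<close>

lemma slope_pairing_nonneg:
  assumes be: "be \<noteq> 0"
    and min: "\<And>al' be'. planar_objective r al be \<le> planar_objective r al' be' + ((al' - al)\<^sup>2 + (be' - be)\<^sup>2)"
  shows "0 \<le> slope_pairing r al be p q"
proof -
  define h where "h = (\<lambda>n. inverse (real (Suc n)))"
  have h: "h \<longlonglongrightarrow> 0" "h n > 0" "h n \<le> 1" for n
    using LIMSEQ_inverse_real_of_nat by (auto simp: h_def inverse_le_1_iff)
  define g where "g = (\<lambda>n t. (\<bar>((al + be * t) + h n * (p + q * t))\<^sup>2 - r\<^sup>2\<bar> - \<bar>(al + be * t)\<^sup>2 - r\<^sup>2\<bar>) / h n)"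
  have obj: "planar_objective r (al + h n * p) (be + h n * q) =
      (\<integral>t. \<bar>((al + be * t) + h n * (p + q * t))\<^sup>2 - r\<^sup>2\<bar> \<partial>slope_measure)"
    and intg: "integrable slope_measure (\<lambda>t. \<bar>((al + be * t) + h n * (p + q * t))\<^sup>2 - r\<^sup>2\<bar>)" for n
  proof -
    have eq: "al + h n * p + (be + h n * q) * t = (al + be * t) + h n * (p + q * t)" for t
      by (simp add: algebra_simps)
    show "planar_objective r (al + h n * p) (be + h n * q) =
        (\<integral>t. \<bar>((al + be * t) + h n * (p + q * t))\<^sup>2 - r\<^sup>2\<bar> \<partial>slope_measure)"
      "integrable slope_measure (\<lambda>t. \<bar>((al + be * t) + h n * (p + q * t))\<^sup>2 - r\<^sup>2\<bar>)"
      using integrable_slope_objective[of "al + h n * p" "be + h n * q" r]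
      unfolding planar_objective_def eq by simp_all
  qed
  have lower: "- (h n * (p\<^sup>2 + q\<^sup>2)) \<le> (\<integral>t. g n t \<partial>slope_measure)" for n
  proof -
    have "planar_objective r al be \<le> planar_objective r (al + h n * p) (be + h n * q) + h n * (h n * (p\<^sup>2 + q\<^sup>2))"
      using min[of "al + h n * p" "be + h n * q"]
      by (simp add: power_mult_distrib power2_eq_square algebra_simps)
    then have "- (h n * (h n * (p\<^sup>2 + q\<^sup>2))) \<le> planar_objective r (al + h n * p) (be + h n * q) - planar_objective r al be"
      by linarith
    then have "- (h n * (p\<^sup>2 + q\<^sup>2)) \<le> (planar_objective r (al + h n * p) (be + h n * q) - planar_objective r al be) / h n"
      using h(2)[of n] by (simp add: pos_le_divide_eq mult.commute)
    also have "\<dots> = (\<integral>t. g n t \<partial>slope_measure)"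
      unfolding obj g_def using intg[of n] integrable_slope_objective[of al be r]
      by (simp add: planar_objective_def)
    finally show ?thesis .
  qed
  have "(\<lambda>n. \<integral>t. g n t \<partial>slope_measure) \<longlonglongrightarrow>
      (\<integral>t. 2 * (sgn ((al + be * t)\<^sup>2 - r\<^sup>2) * ((al + be * t) * (p + q * t))) \<partial>slope_measure)"
  \<comment> \<open>The bound is uniform in \<open>n\<close> because \<open>h n\<close> is at most
    one.\<close>
  proof (rule integral_dominated_convergence[where w = "\<lambda>t. 2 * \<bar>(al + be * t) * (p + q * t)\<bar> + (p + q * t) * (p + q * t)"])
    show "AE t in slope_measure. (\<lambda>n. g n t) \<longlonglongrightarrow> 2 * (sgn ((al + be * t)\<^sup>2 - r\<^sup>2) * ((al + be * t) * (p + q * t)))"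
      \<comment> \<open>As \<open>be\<close> is nonzero, the kinks occur only at these two
        slopes.\<close>
      using AE_slope_measure_neq[of "(r - al) / be"] AE_slope_measure_neq[of "(- r - al) / be"]
    proof eventually_elim
      case (elim t)
      then have "al + be * t \<noteq> r" "al + be * t \<noteq> - r"
        using be by (auto simp: field_simps)
      then have "(al + be * t)\<^sup>2 \<noteq> r\<^sup>2"
        by (simp add: power2_eq_iff)
      then show ?case
        unfolding g_def using h(1,2) by (intro abs_difference_quotient_LIMSEQ) (auto simp: less_imp_neq[symmetric])
    qed
  next
    fix n
    show "AE t in slope_measure. norm (g n t) \<le> 2 * \<bar>(al + be * t) * (p + q * t)\<bar> + (p + q * t) * (p + q * t)"
    proof (rule AE_I2)
      fix t
      define c d where "c = al + be * t" and "d = p + q * t"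
      have "\<bar>\<bar>(c + h n * d)\<^sup>2 - r\<^sup>2\<bar> - \<bar>c\<^sup>2 - r\<^sup>2\<bar>\<bar> \<le> \<bar>((c + h n * d)\<^sup>2 - r\<^sup>2) - (c\<^sup>2 - r\<^sup>2)\<bar>"
        by (rule abs_triangle_ineq3)
      also have "((c + h n * d)\<^sup>2 - r\<^sup>2) - (c\<^sup>2 - r\<^sup>2) = h n * (2 * (c * d) + h n * (d * d))"
        by (simp add: algebra_simps power2_eq_square)
      also have "\<bar>\<dots>\<bar> = h n * \<bar>2 * (c * d) + h n * (d * d)\<bar>"
        using h(2)[of n] by (simp add: abs_mult)
      also have "\<dots> \<le> h n * (2 * \<bar>c * d\<bar> + 1 * (d * d))"
      proof (rule mult_left_mono)
        have "h n * (d * d) \<le> 1 * (d * d)" "0 \<le> h n * (d * d)"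
          using h(2,3)[of n] mult_right_mono[of "h n" 1 "d * d"] by simp_all
        then show "\<bar>2 * (c * d) + h n * (d * d)\<bar> \<le> 2 * \<bar>c * d\<bar> + 1 * (d * d)"
          by linarith
      qed (use h(2)[of n] in simp)
      finally show "norm (g n t) \<le> 2 * \<bar>(al + be * t) * (p + q * t)\<bar> + (p + q * t) * (p + q * t)"
        using h(2)[of n] by (simp add: g_def c_def d_def abs_divide pos_divide_le_eq mult.commute)
    qed
  next
    show "integrable slope_measure (\<lambda>t. 2 * \<bar>(al + be * t) * (p + q * t)\<bar> + (p + q * t) * (p + q * t))"
      by (intro Bochner_Integration.integrable_add integrable_mult_right integrable_abs) simp_all
  qed (auto simp: g_def)
  moreover have "(\<lambda>n. - (h n * (p\<^sup>2 + q\<^sup>2))) \<longlonglongrightarrow> - (0 * (p\<^sup>2 + q\<^sup>2))"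
    by (intro tendsto_intros h(1))
  ultimately have "- (0 * (p\<^sup>2 + q\<^sup>2)) \<le> (\<integral>t. 2 * (sgn ((al + be * t)\<^sup>2 - r\<^sup>2) * ((al + be * t) * (p + q * t))) \<partial>slope_measure)"
    using lower by (intro LIMSEQ_le) auto
  then show ?thesis
    by (simp add: slope_pairing_def)
qed

text \<open>The pairing is linear in the direction, so nonnegativity for opposite directions forces
  zero. The converse is \<open>planar_objective_ge\<close>, whose quadratic error matches the
  penalty exactly.\<close>

lemma planar_stationary_iff:
  assumes "be \<noteq> 0"
  shows "(\<forall>al' be'. planar_objective r al be \<le> planar_objective r al' be' + ((al' - al)\<^sup>2 + (be' - be)\<^sup>2))
    \<longleftrightarrow> (\<forall>p q. slope_pairing r al be p q = 0)"
proof
  assume min: "\<forall>al' be'. planar_objective r al be \<le> planar_objective r al' be' + ((al' - al)\<^sup>2 + (be' - be)\<^sup>2)"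
  show "\<forall>p q. slope_pairing r al be p q = 0"
  proof (intro allI)
    fix p q
    have "0 \<le> slope_pairing r al be p q" "0 \<le> slope_pairing r al be (- p) (- q)"
      using min by (auto intro!: slope_pairing_nonneg[OF assms])
    moreover have "slope_pairing r al be (- p) (- q) = - slope_pairing r al be p q"
      using slope_pairing_linear[of r al be p q] slope_pairing_linear[of r al be "- p" "- q"] by simp
    ultimately show "slope_pairing r al be p q = 0" by linarith
  qed
next
  assume zero: "\<forall>p q. slope_pairing r al be p q = 0"
  show "\<forall>al' be'. planar_objective r al be \<le> planar_objective r al' be' + ((al' - al)\<^sup>2 + (be' - be)\<^sup>2)"
  proof (intro allI)
    fix al' be'
    show "planar_objective r al be \<le> planar_objective r al' be' + ((al' - al)\<^sup>2 + (be' - be)\<^sup>2)"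
      using planar_objective_ge[of r al be "al' - al" "be' - be"] zero by simp
  qed
qed

section \<open>The gradient in closed form\<close>

definition slope_antideriv :: "real \<Rightarrow> real \<Rightarrow> real \<Rightarrow> real \<Rightarrow> real \<Rightarrow> real" where
  "slope_antideriv p q p' q' t =
     (p * p' * (arctan t + t / (1 + t\<^sup>2)) - (p * q' + q * p') / (1 + t\<^sup>2)
       + q * q' * (arctan t - t / (1 + t\<^sup>2))) / pi"

text \<open>The three summands, divided by \<open>pi\<close>, are antiderivatives of the density
  times \<open>1\<close>, \<open>t\<close> and \<open>t^2\<close>, weighted by the coefficients of
  the product of the affine factors.\<close>

lemma slope_antideriv_deriv:
  "(slope_antideriv p q p' q' has_real_derivative slope_density t * ((p + q * t) * (p' + q' * t))) (at t)"
proof -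
  define D where "D = 1 + t\<^sup>2"
  have D: "D \<noteq> 0" "t * t = D - 1" by (simp_all add: D_def power2_eq_square sum_squares_eq_zero_iff add_nonneg_eq_0_iff)
  have nz: "1 + t\<^sup>2 \<noteq> 0" using D by (simp add: D_def)
  have at: "(arctan has_real_derivative 1 / D) (at t)"
    using DERIV_arctan[of t] by (simp add: D_def inverse_eq_divide)
  have quot: "((\<lambda>t. t / (1 + t\<^sup>2)) has_real_derivative (1 * (1 + t\<^sup>2) - t * (2 * t)) / ((1 + t\<^sup>2) * (1 + t\<^sup>2))) (at t)"
    by (rule derivative_eq_intros refl nz | simp)+
  have inv: "((\<lambda>t. c / (1 + t\<^sup>2)) has_real_derivative (0 * (1 + t\<^sup>2) - c * (2 * t)) / ((1 + t\<^sup>2) * (1 + t\<^sup>2))) (at t)" for c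
    by (rule derivative_eq_intros refl nz | simp)+
  have "(slope_antideriv p q p' q' has_real_derivative
      (p * p' * (1 / D + (1 * (1 + t\<^sup>2) - t * (2 * t)) / ((1 + t\<^sup>2) * (1 + t\<^sup>2)))
       - (0 * (1 + t\<^sup>2) - (p * q' + q * p') * (2 * t)) / ((1 + t\<^sup>2) * (1 + t\<^sup>2))
       + q * q' * (1 / D - (1 * (1 + t\<^sup>2) - t * (2 * t)) / ((1 + t\<^sup>2) * (1 + t\<^sup>2)))) / pi) (at t)"
    unfolding slope_antideriv_def
    by (intro DERIV_cdivide DERIV_add DERIV_diff DERIV_cmult at quot inv)
  also have "p * p' * (1 / D + (1 * (1 + t\<^sup>2) - t * (2 * t)) / ((1 + t\<^sup>2) * (1 + t\<^sup>2)))
       - (0 * (1 + t\<^sup>2) - (p * q' + q * p') * (2 * t)) / ((1 + t\<^sup>2) * (1 + t\<^sup>2))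
       + q * q' * (1 / D - (1 * (1 + t\<^sup>2) - t * (2 * t)) / ((1 + t\<^sup>2) * (1 + t\<^sup>2)))
     = (2 * (p * p') + 2 * (p * q' + q * p') * t + 2 * (q * q') * (t * t)) / (D * D)"
  proof -
    define X Y Z where "X = p * p'" and "Y = p * q' + q * p'" and "Z = q * q'"
    have "1 / D + (2 - D) / (D * D) = 2 / (D * D)" "1 / D - (2 - D) / (D * D) = 2 * (D - 1) / (D * D)"
      using D(1) by (simp_all add: field_simps)
    moreover have "1 * D - t * (2 * t) = 2 - D"
      using D(2) by simp
    ultimately show ?thesis
      unfolding D_def[symmetric] D(2) X_def[symmetric] Y_def[symmetric] Z_def[symmetric]
      by (simp only:) (simp add: add_divide_distrib mult_ac)
  qed
  also have "\<dots> / pi = slope_density t * ((p + q * t) * (p' + q' * t))"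
  proof -
    have "slope_density t = 2 / pi / (D * D)"
      by (simp add: slope_density_def D_def power2_eq_square)
    then show ?thesis by (simp add: algebra_simps add_divide_distrib)
  qed
  finally show ?thesis .
qed

lemma integral_slope_Icc:
  assumes "u \<le> v"
  shows "(\<integral>t. indicator {u..v} t * ((p + q * t) * (p' + q' * t)) \<partial>slope_measure)
    = slope_antideriv p q p' q' v - slope_antideriv p q p' q' u"
proof -
  have "(\<integral>t. indicator {u..v} t * ((p + q * t) * (p' + q' * t)) \<partial>slope_measure) =
      (\<integral>t. slope_density t * ((p + q * t) * (p' + q' * t)) * indicator {u..v} t \<partial>lborel)"
    unfolding slope_measure_def
    by (subst integral_density) (auto simp: slope_density_nonneg mult_ac intro!: Bochner_Integration.integral_cong)
  also have "\<dots> = slope_antideriv p q p' q' v - slope_antideriv p q p' q' u"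
  proof (rule integral_FTC_Icc_real[OF assms slope_antideriv_deriv])
    fix t :: real
    have "1 + t\<^sup>2 \<noteq> 0" by (simp add: add_nonneg_eq_0_iff)
    then show "isCont (\<lambda>t. slope_density t * ((p + q * t) * (p' + q' * t))) t"
      unfolding slope_density_def by (intro continuous_intros) simp_all
  qed
  finally show ?thesis .
qed

text \<open>The sign is negative strictly between \<open>u\<close> and \<open>v\<close> and positive
  outside, so twice the integral over the interval is subtracted from the full one. At the two
  endpoints the sign is zero, hence equality only almost everywhere.\<close>

lemma slope_pairing_eq:
  fixes r al be p q :: real
  assumes r: "0 \<le> r" and be: "0 < be"
  defines "u \<equiv> (- r - al) / be" and "v \<equiv> (r - al) / be"
  shows "slope_pairing r al be p q =
    al * p + be * q - 2 * (slope_antideriv al be p q v - slope_antideriv al be p q u)"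
proof -
  have uv: "u \<le> v"
    unfolding u_def v_def using r be by (intro divide_right_mono) auto
  define g where "g = (\<lambda>t. (al + be * t) * (p + q * t))"
  have int: "integrable slope_measure g" "integrable slope_measure (\<lambda>t. indicator {u..v} t * g t)"
  proof -
    show 1: "integrable slope_measure g" by (simp add: g_def)
    have "integrable slope_measure (\<lambda>t. g t * indicator {u..v} t)"
      by (rule integrable_real_mult_indicator[OF _ 1]) (simp add: sets_slope_measure)
    then show "integrable slope_measure (\<lambda>t. indicator {u..v} t * g t)" by (simp add: mult.commute)
  qed
  have "slope_pairing r al be p q = (\<integral>t. g t - 2 * (indicator {u..v} t * g t) \<partial>slope_measure)"
    unfolding slope_pairing_def
  proof (rule integral_cong_AE)
    show "AE t in slope_measure. sgn ((al + be * t)\<^sup>2 - r\<^sup>2) * ((al + be * t) * (p + q * t)) =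
        g t - 2 * (indicator {u..v} t * g t)"
      using AE_slope_measure_neq[of u] AE_slope_measure_neq[of v]
    proof eventually_elim
      case (elim t)
      have ut: "t < u \<longleftrightarrow> al + be * t < - r" "u < t \<longleftrightarrow> - r < al + be * t"
        and vt: "t < v \<longleftrightarrow> al + be * t < r" "v < t \<longleftrightarrow> r < al + be * t"
        using be by (auto simp: u_def v_def field_simps)
      show ?case
      proof (cases "t \<in> {u..v}")
        case True
        then have "\<bar>al + be * t\<bar> < r" using ut vt elim by auto
        then have "(al + be * t)\<^sup>2 < r\<^sup>2" by (metis abs_ge_zero power2_abs power_strict_mono pos2)
        then show ?thesis using True by (simp add: g_def)
      next
        case False
        then have "r < \<bar>al + be * t\<bar>" using ut vt by auto
        then have "r\<^sup>2 < (al + be * t)\<^sup>2" using r by (metis power2_abs power_strict_mono pos2)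
        then show ?thesis using False by (simp add: g_def)
      qed
    qed
  qed (auto simp: g_def)
  also have "\<dots> = al * p + be * q - 2 * (\<integral>t. indicator {u..v} t * g t \<partial>slope_measure)"
    using int by (simp add: g_def integral_slope_affine_mult)
  finally show ?thesis
    by (simp add: g_def integral_slope_Icc[OF uv])
qed

text \<open>In the direction \<open>(be, - al)\<close>, orthogonal to the point, the linear terms and the arctangents
  cancel and only a rational equation remains.\<close>

lemma planar_critical_axis:
  assumes r: "0 < r" and be: "0 < be" and zero: "\<forall>p q. slope_pairing r al be p q = 0"
  shows "al = 0"
proof -
  define u v where "u = (- r - al) / be" and "v = (r - al) / be"
  have eq: "slope_antideriv al be be (- al) t = ((2 * al * (be * t) - be\<^sup>2 + al\<^sup>2) / (1 + t\<^sup>2)) / pi" for t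
    unfolding slope_antideriv_def by (simp add: algebra_simps add_divide_distrib diff_divide_distrib power2_eq_square)
  have sq: "1 + ((s - al) / be)\<^sup>2 = (be\<^sup>2 + (s - al)\<^sup>2) / be\<^sup>2" for s
    using be by (simp add: power_divide field_simps)
  \<comment> \<open>The endpoints are \<open>s = r\<close> and \<open>s = - r\<close>. The value
    depends on \<open>s\<close> only through the squared distance from \<open>(al, be)\<close> to
    \<open>(s, 0)\<close>, so a critical point is equidistant from both.\<close>
  have val: "slope_antideriv al be be (- al) ((s - al) / be) = be\<^sup>2 * (r\<^sup>2 / (be\<^sup>2 + (s - al)\<^sup>2) - 1) / pi"
    if "s\<^sup>2 = r\<^sup>2" for s
  proof -
    define E where "E = be\<^sup>2 + (s - al)\<^sup>2"
    have E: "E > 0" using be by (simp add: E_def add_pos_nonneg)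
    have "2 * al * (s - al) - be\<^sup>2 + al\<^sup>2 = r\<^sup>2 - E"
      unfolding E_def that[symmetric] by algebra
    moreover have "be * ((s - al) / be) = s - al" using be by simp
    ultimately have "slope_antideriv al be be (- al) ((s - al) / be) = ((r\<^sup>2 - E) / (E / be\<^sup>2)) / pi"
      unfolding eq sq E_def[symmetric] by simp
    also have "\<dots> = be\<^sup>2 * (r\<^sup>2 / E - 1) / pi"
      using E be by (simp add: field_simps)
    finally show ?thesis by (simp add: E_def)
  qed
  have "slope_antideriv al be be (- al) v = slope_antideriv al be be (- al) u"
    using slope_pairing_eq[of r be al be "- al"] zero r be by (simp add: u_def v_def)
  then have "r\<^sup>2 / (be\<^sup>2 + (r - al)\<^sup>2) = r\<^sup>2 / (be\<^sup>2 + (- r - al)\<^sup>2)"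
    using val[of r] val[of "- r"] be unfolding u_def v_def by simp
  moreover have "be\<^sup>2 + (r - al)\<^sup>2 > 0" "be\<^sup>2 + (- r - al)\<^sup>2 > 0"
    using be by (simp_all add: add_pos_nonneg)
  ultimately have "be\<^sup>2 + (r - al)\<^sup>2 = be\<^sup>2 + (- r - al)\<^sup>2"
    using r by (metis divide_cancel_left less_irrefl power_not_zero)
  then have "r * al = 0" by (simp add: power2_eq_square algebra_simps)
  then show ?thesis using r by simp
qed

text \<open>For \<open>al = 0\<close> the interval is symmetric with endpoints plus and minus
  \<open>1 / c\<close>: the odd contribution of \<open>p\<close> cancels, and the reciprocal formula
  for the arctangent produces the expression in \<open>c = be / r\<close>.\<close>

lemma slope_pairing_perpendicular:
  assumes r: "0 < r" and be: "0 < be"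
  shows "slope_pairing r 0 be p q =
    4 * be * q / pi * (be / r / (1 + (be / r)\<^sup>2) + arctan (be / r) - pi / 4)"
proof -
  define c where "c = be / r"
  have c: "c > 0" using r be by (simp add: c_def)
  have rc: "r / be = 1 / c" by (simp add: c_def)
  have at: "arctan (1 / c) = pi / 2 - arctan c"
    using arctan_inverse[of c] c by (simp add: inverse_eq_divide)
  have quot: "1 / c / (1 + (1 / c)\<^sup>2) = c / (1 + c\<^sup>2)"
    using c by (simp add: field_simps power2_eq_square)
  have "slope_antideriv 0 be p q (1 / c) - slope_antideriv 0 be p q (- (1 / c))
      = 2 * (be * q) * (arctan (1 / c) - 1 / c / (1 + (1 / c)\<^sup>2)) / pi"
    by (simp only: slope_antideriv_def arctan_minus power2_minus minus_divide_left[symmetric])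
       (simp add: algebra_simps add_divide_distrib diff_divide_distrib)
  then have "slope_pairing r 0 be p q = be * q - 4 * (be * q) * (pi / 2 - arctan c - c / (1 + c\<^sup>2)) / pi"
    using slope_pairing_eq[of r be 0 p q] r be unfolding at quot by (simp add: rc minus_divide_left[symmetric])
  also have "\<dots> = 4 * be * q / pi * (c / (1 + c\<^sup>2) + arctan c - pi / 4)"
    by (simp add: algebra_simps diff_divide_distrib add_divide_distrib)
  finally show ?thesis by (simp add: c_def)
qed

lemma planar_critical_iff:
  assumes r: "0 < r" and be: "0 < be"
  shows "(\<forall>p q. slope_pairing r al be p q = 0) \<longleftrightarrow>
    al = 0 \<and> pi / 4 = be / r / (1 + (be / r)\<^sup>2) + arctan (be / r)"
proof
  assume zero: "\<forall>p q. slope_pairing r al be p q = 0"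
  then have al: "al = 0" by (rule planar_critical_axis[OF r be])
  then show "al = 0 \<and> pi / 4 = be / r / (1 + (be / r)\<^sup>2) + arctan (be / r)"
    using zero slope_pairing_perpendicular[OF r be, of 0 1] be by auto
next
  assume "al = 0 \<and> pi / 4 = be / r / (1 + (be / r)\<^sup>2) + arctan (be / r)"
  then show "\<forall>p q. slope_pairing r al be p q = 0"
    by (simp add: slope_pairing_perpendicular[OF r be])
qed

section \<open>Stationary points of the objective\<close>

text \<open>Off the line the normalised residual serves as second axis; on the line it is zero and
  the collinear formula takes over.\<close>

lemma f_P_coordinates:
  fixes a :: "'w \<Rightarrow> real ^ 'd"
  assumes a: "std_gaussian_vector M a" and e: "norm e = 1"
  shows "f_P M a (r *\<^sub>R e) x = planar_objective r (x \<bullet> e) (norm (x - (x \<bullet> e) *\<^sub>R e))"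
proof (cases "x - (x \<bullet> e) *\<^sub>R e = 0")
  case True
  then show ?thesis
    using f_P_collinear[OF a e, of r "x \<bullet> e"] by (simp add: planar_objective_collinear)
next
  case False
  define y where "y = x - (x \<bullet> e) *\<^sub>R e"
  define e2 where "e2 = y /\<^sub>R norm y"
  have y: "y \<noteq> 0" "e \<bullet> y = 0"
    using False e by (simp_all add: y_def inner_diff_right inner_commute dot_square_norm)
  then have e2: "norm e2 = 1" "e \<bullet> e2 = 0" "norm y *\<^sub>R e2 = y"
    by (simp_all add: e2_def)
  have "x = (x \<bullet> e) *\<^sub>R e + norm y *\<^sub>R e2"
    unfolding e2(3) by (simp add: y_def)
  then show ?thesis
    using f_P_planar[OF a e e2(1,2), of r "x \<bullet> e" "norm y"] by (simp add: y_def)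
qed

lemma norm_square_decomposition:
  fixes e :: "'a::real_inner"
  assumes "norm e = 1"
  shows "(norm x)\<^sup>2 = (x \<bullet> e)\<^sup>2 + (norm (x - (x \<bullet> e) *\<^sub>R e))\<^sup>2"
proof -
  have "e \<bullet> e = 1" using assms by (simp add: dot_square_norm)
  then show ?thesis
    unfolding power2_norm_eq_inner
    by (simp add: inner_diff_left inner_diff_right inner_commute power2_eq_square)
qed

text \<open>Planar competitors are realised isometrically in the plane of \<open>e\<close> and the
  residual of \<open>x\<close>. Conversely, taking the two coordinates does not increase distances,
  so the planar penalty is below the one in the full space.\<close>

lemma f_P_min_iff_planar:
  fixes a :: "'w \<Rightarrow> real ^ 'd" and x e :: "real ^ 'd"
  assumes a: "std_gaussian_vector M a" and e: "norm e = 1"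
  defines "be \<equiv> norm (x - (x \<bullet> e) *\<^sub>R e)"
  assumes be: "be \<noteq> 0"
  shows "(\<forall>y. f_P M a (r *\<^sub>R e) x \<le> f_P M a (r *\<^sub>R e) y + (norm (y - x))\<^sup>2) \<longleftrightarrow>
    (\<forall>al' be'. planar_objective r (x \<bullet> e) be \<le> planar_objective r al' be' + ((al' - x \<bullet> e)\<^sup>2 + (be' - be)\<^sup>2))"
    (is "?L \<longleftrightarrow> ?R")
proof
  assume L: ?L
  define z where "z = x - (x \<bullet> e) *\<^sub>R e"
  define e2 where "e2 = z /\<^sub>R norm z"
  have z: "z \<noteq> 0" "e \<bullet> z = 0" "be = norm z"
    using be e by (auto simp: z_def be_def inner_diff_right inner_commute dot_square_norm)
  then have e2: "norm e2 = 1" "e \<bullet> e2 = 0" "be *\<^sub>R e2 = z"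
    by (simp_all add: e2_def)
  show ?R
  proof (intro allI)
    fix al' be'
    define y where "y = al' *\<^sub>R e + be' *\<^sub>R e2"
    have diff: "y - x = (al' - x \<bullet> e) *\<^sub>R e + (be' - be) *\<^sub>R e2"
      by (simp add: y_def e2(3) z_def algebra_simps)
    have "(norm (y - x))\<^sup>2 = (al' - x \<bullet> e)\<^sup>2 + (be' - be)\<^sup>2"
    proof -
      have "e \<bullet> e = 1" "e2 \<bullet> e2 = 1" "e2 \<bullet> e = 0"
        using e e2(1,2) by (simp_all add: dot_square_norm inner_commute)
      then show ?thesis
        unfolding power2_norm_eq_inner diff
        using e2(2) by (simp add: inner_add_left inner_add_right power2_eq_square)
    qed
    moreover have "f_P M a (r *\<^sub>R e) y = planar_objective r al' be'"
      unfolding y_def by (rule f_P_planar[OF a e e2(1,2)])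
    ultimately show "planar_objective r (x \<bullet> e) be \<le> planar_objective r al' be' + ((al' - x \<bullet> e)\<^sup>2 + (be' - be)\<^sup>2)"
      using L f_P_coordinates[OF a e, of r x] by (metis be_def)
  qed
next
  assume R: ?R
  show ?L
  proof
    fix y
    define be' where "be' = norm (y - (y \<bullet> e) *\<^sub>R e)"
    have "(y - x) - ((y - x) \<bullet> e) *\<^sub>R e = (y - (y \<bullet> e) *\<^sub>R e) - (x - (x \<bullet> e) *\<^sub>R e)"
      by (simp add: inner_diff_left algebra_simps)
    then have "\<bar>be' - be\<bar> \<le> norm ((y - x) - ((y - x) \<bullet> e) *\<^sub>R e)"
      unfolding be'_def be_def by (metis norm_triangle_ineq3)
    then have "(be' - be)\<^sup>2 \<le> (norm ((y - x) - ((y - x) \<bullet> e) *\<^sub>R e))\<^sup>2"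
      by (metis abs_ge_zero power2_abs power_mono)
    then have "(y \<bullet> e - x \<bullet> e)\<^sup>2 + (be' - be)\<^sup>2 \<le> (norm (y - x))\<^sup>2"
      using norm_square_decomposition[OF e, of "y - x"] by (simp add: inner_diff_left)
    moreover have "planar_objective r (x \<bullet> e) be \<le> planar_objective r (y \<bullet> e) be' + ((y \<bullet> e - x \<bullet> e)\<^sup>2 + (be' - be)\<^sup>2)"
      using R by blast
    ultimately show "f_P M a (r *\<^sub>R e) x \<le> f_P M a (r *\<^sub>R e) y + (norm (y - x))\<^sup>2"
      unfolding f_P_coordinates[OF a e] be_def be'_def by linarith
  qed
qed

text \<open>The objective is nonnegative and vanishes at \<open>z\<close> and \<open>- z\<close>. At
  the origin the triangle inequality under the expectation suffices.\<close>

lemma f_P_min_at_zero_or_signal: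
  fixes a :: "'w \<Rightarrow> real ^ 'd"
  assumes a: "std_gaussian_vector M a" and x: "x \<in> {0, z, - z}"
  shows "f_P M a z x \<le> f_P M a z y + (norm (y - x))\<^sup>2"
proof (cases "x = 0")
  case True
  note sq = has_bochner_integral_gaussian_inner_square[OF a]
  note int = f_P_integrable[OF a]
  have "f_P M a z 0 \<le> (\<integral>\<omega>. \<bar>(a \<omega> \<bullet> y)\<^sup>2 - (a \<omega> \<bullet> z)\<^sup>2\<bar> + (a \<omega> \<bullet> y)\<^sup>2 \<partial>M)"
    unfolding f_P_def
    by (rule integral_mono) (use sq int[of 0 z] int[of y z] in \<open>auto simp: has_bochner_integral_iff\<close>)
  also have "\<dots> = f_P M a z y + (norm y)\<^sup>2"
    using sq int[of y z] by (simp add: f_P_def has_bochner_integral_iff)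
  finally show ?thesis by (simp add: True)
next
  case False
  with x have "f_P M a z x = 0" by (auto simp: f_P_def)
  moreover have "0 \<le> f_P M a z y" by (simp add: f_P_def)
  ultimately show ?thesis by simp
qed

text \<open>The objective value factors as the distance of \<open>\<bar>al\<bar>\<close> from
  \<open>r\<close> times \<open>r + \<bar>al\<bar>\<close>, against a penalty equal to that distance
  squared at the nearer zero. Cancelling the distance is contradictory unless
  \<open>al = 0\<close>.\<close>

lemma f_P_min_collinear:
  fixes a :: "'w \<Rightarrow> real ^ 'd"
  assumes a: "std_gaussian_vector M a" and e: "norm e = 1" and r: "0 < r"
    and min: "\<And>y. f_P M a (r *\<^sub>R e) (al *\<^sub>R e) \<le> f_P M a (r *\<^sub>R e) y + (norm (y - al *\<^sub>R e))\<^sup>2"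
  shows "al = 0 \<or> \<bar>al\<bar> = r"
proof (rule ccontr)
  assume neg: "\<not> (al = 0 \<or> \<bar>al\<bar> = r)"
  text \<open>Compare with the zeros \<open>\<plusminus> r *\<^sub>R e\<close> of the objective.\<close>
  have "\<bar>al\<^sup>2 - r\<^sup>2\<bar> \<le> (s - al)\<^sup>2" if "s\<^sup>2 = r\<^sup>2" for s
    using min[of "s *\<^sub>R e"] e that
    by (simp add: f_P_collinear[OF a e] power_mult_distrib flip: scaleR_left_diff_distrib)
  from this[of r] this[of "- r"] have "\<bar>\<bar>al\<bar>\<^sup>2 - r\<^sup>2\<bar> \<le> (r - \<bar>al\<bar>)\<^sup>2"
    by (cases "0 \<le> al") (auto simp: power2_eq_square algebra_simps)
  moreover have "\<bar>\<bar>al\<bar>\<^sup>2 - r\<^sup>2\<bar> = \<bar>r - \<bar>al\<bar>\<bar> * (r + \<bar>al\<bar>)"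
  proof -
    have "\<bar>al\<bar>\<^sup>2 - r\<^sup>2 = - ((r - \<bar>al\<bar>) * (r + \<bar>al\<bar>))" by (simp add: power2_eq_square algebra_simps)
    then show ?thesis using r by (simp add: abs_mult)
  qed
  moreover have "(r - \<bar>al\<bar>)\<^sup>2 = \<bar>r - \<bar>al\<bar>\<bar> * \<bar>r - \<bar>al\<bar>\<bar>" by (simp add: power2_eq_square)
  moreover have "0 < \<bar>r - \<bar>al\<bar>\<bar>" using neg by simp
  ultimately have "\<bar>r - \<bar>al\<bar>\<bar> * (r + \<bar>al\<bar>) \<le> \<bar>r - \<bar>al\<bar>\<bar> * \<bar>r - \<bar>al\<bar>\<bar>" by linarith
  then have "r + \<bar>al\<bar> \<le> \<bar>r - \<bar>al\<bar>\<bar>"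
    using \<open>0 < \<bar>r - \<bar>al\<bar>\<bar>\<close> by (rule mult_left_le_imp_le)
  then show False using neg r by (auto simp: abs_if split: if_splits)
qed

theorem theorem5p2:
  fixes M :: "'w measure" and a :: "'w \<Rightarrow> real ^ 'd" and xbar :: "real ^ 'd"
  assumes "xbar \<noteq> 0"
    and "std_gaussian_vector M a"
  shows "\<exists>c::real. c > 0 \<and> \<bar>c - 0.4416\<bar> < 0.00005 \<and>
           (\<forall>t::real. pi / 4 = t / (1 + t\<^sup>2) + arctan t \<longleftrightarrow> t = c) \<and>
           {x. stationary (f_P M a xbar) x} =
             {0} \<union> {xbar, - xbar} \<union> {x. x \<bullet> xbar = 0 \<and> norm x = c * norm xbar}"
proof -
  note a = assms(2)
  obtain c :: real where c: "c > 0" "\<bar>c - 0.4416\<bar> < 0.00005"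
    and eq: "\<And>t. pi / 4 = t / (1 + t\<^sup>2) + arctan t \<longleftrightarrow> t = c"
    using critical_radius by blast
  define r where "r = norm xbar"
  define e where "e = xbar /\<^sub>R r"
  have r: "0 < r" and e: "norm e = 1" and xbar: "xbar = r *\<^sub>R e"
    using assms(1) by (simp_all add: r_def e_def)
  have stat: "stationary (f_P M a xbar) x \<longleftrightarrow> (\<forall>y. f_P M a xbar x \<le> f_P M a xbar y + (norm (y - x))\<^sup>2)" for x
    by (rule stationary_weakly_convex_iff) (rule f_P_weakly_convex[OF a])
  have "stationary (f_P M a xbar) x \<longleftrightarrow>
      x \<in> {0, xbar, - xbar} \<or> (x \<bullet> xbar = 0 \<and> norm x = c * norm xbar)" for x
  \<comment> \<open>The gradient criterion requires a nonzero distance from the signal line, so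
    points on the line are treated by comparison.\<close>
  proof (cases "norm (x - (x \<bullet> e) *\<^sub>R e) = 0")
    case True
    then have x: "x = (x \<bullet> e) *\<^sub>R e" by simp
    have perp: "\<not> (x \<bullet> xbar = 0 \<and> norm x = c * norm xbar)"
    proof
      assume "x \<bullet> xbar = 0 \<and> norm x = c * norm xbar"
      moreover from this have "x \<bullet> e = 0" using r by (simp add: xbar)
      ultimately have "c * norm xbar = 0" using x by simp
      then show False using c(1) assms(1) by simp
    qed
    show ?thesis
    proof
      assume "stationary (f_P M a xbar) x"
      then have "f_P M a xbar x \<le> f_P M a xbar y + (norm (y - x))\<^sup>2" for y
        unfolding stat by blast
      then have "x \<bullet> e = 0 \<or> \<bar>x \<bullet> e\<bar> = r"
        by (intro f_P_min_collinear[OF a e r]) (simp only: x[symmetric] xbar[symmetric])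
      then have "x \<bullet> e = 0 \<or> x \<bullet> e = r \<or> x \<bullet> e = - r" by linarith
      then show "x \<in> {0, xbar, - xbar} \<or> (x \<bullet> xbar = 0 \<and> norm x = c * norm xbar)"
        using x unfolding xbar by (metis insertCI scaleR_minus_left scaleR_zero_left)
    next
      assume "x \<in> {0, xbar, - xbar} \<or> (x \<bullet> xbar = 0 \<and> norm x = c * norm xbar)"
      then show "stationary (f_P M a xbar) x"
        unfolding stat using perp f_P_min_at_zero_or_signal[OF a] by blast
    qed
  next
    case False
    define be where "be = norm (x - (x \<bullet> e) *\<^sub>R e)"
    have be: "be > 0" using False by (simp add: be_def)
    have nontriv: "x \<notin> {0, xbar, - xbar}"
      using False e by (auto simp: xbar dot_square_norm)
    have "stationary (f_P M a xbar) x \<longleftrightarrow> (\<forall>p q. slope_pairing r (x \<bullet> e) be p q = 0)"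
      unfolding stat unfolding xbar f_P_min_iff_planar[OF a e False, of r] be_def
      by (rule planar_stationary_iff[OF False])
    also have "\<dots> \<longleftrightarrow> x \<bullet> e = 0 \<and> be / r = c"
      using planar_critical_iff[OF r be, of "x \<bullet> e"] eq[of "be / r"] by simp
    \<comment> \<open>When \<open>x\<close> is orthogonal to \<open>e\<close> its distance from the
      line is its norm.\<close>
    also have "\<dots> \<longleftrightarrow> x \<bullet> xbar = 0 \<and> norm x = c * norm xbar"
      using r e by (auto simp: xbar be_def field_simps)
    finally show ?thesis using nontriv by blast
  qed
  then have "{x. stationary (f_P M a xbar) x} =
      {0} \<union> {xbar, - xbar} \<union> {x. x \<bullet> xbar = 0 \<and> norm x = c * norm xbar}"
    by auto
  then show ?thesis using c eq by blast
qed

end
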